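(* The sequence $(A_k(q))_{k\geq0}$ defined below is the unique sequence of power series in $q$ satisfying: (a) each $A_k$ is a quasi-modular form of weight $2k$ and $\frac{d}{dG_2}A_k=2A_{k-1}$ (where $A_{-1}:=0$); (b) for every $n\geq0$ there exists a polynomial $p_n(k)$ of degree $2n$ such that for every $k\geq n$, \[ \big[A_k(q)\big]_{q^n}=\frac{1}{(-4)^k(2k+1)!!}\,p_n(k); \] (c) $A_0=1+O(q)$.
   Context: For even $k\geq 2$, $G_k(q)=-\frac{B_k}{2k}+\sum_{n\geq1}\sum_{d|n}d^{k-1}q^n$ ($B_k$ Bernoulli numbers); $G_k:=0$ for odd $k$. The algebra of quasi-modular forms is $\mathsf{QMod}=\mathbb{C}[G_2,G_4,G_6]$ (a free polynomial algebra), graded by weight with $G_k$ of weight $k$; $\frac{d}{dG_2}$ is the partial derivative with respect to the generator $G_2$. $[f]_{q^n}$ denotes the $q^n$-coefficient, $(2k+1)!!=(2k+1)(2k-1)\cdots3\cdot1$. Let $\wp(z)=z^{-2}+2\sum_{k\geq4}G_k\frac{z^{k-2}}{(k-2)!}$ as a formal Laurent series in $z$ with quasi-modular coefficients; let $(\wp-4G_2)^{1/2}$ be the unique formal square root of $\wp(z)-4G_2$ of the form $z^{-1}+O(z)$, and $(\wp-4G_2)^{k+\frac12}:=(\wp-4G_2)^k(\wp-4G_2)^{1/2}$. Define $A_k(q)=\frac{(-1)^k}{(2k+1)!!}\mathrm{Res}_{z=0}\left[(\wp(z)-4G_2)^{k+\frac12}\right]$, where $\mathrm{Res}_{z=0}$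 takes the coefficient of $z^{-1}$. *)

theory Defs
  imports Complex_Main "HOL-Computational_Algebra.Formal_Laurent_Series"
    "HOL-Computational_Algebra.Polynomial"
begin

definition bernoulli :: "nat \<Rightarrow> complex" where
  "bernoulli n = fact n * fps_nth (fps_X / (fps_exp 1 - 1)) n"

definition G :: "nat \<Rightarrow> complex fps" where
  "G k = (if even k \<and> k \<ge> 2 then
     Abs_fps (\<lambda>n. if n = 0 then - bernoulli k / (2 * of_nat k)
                   else (\<Sum>d | d dvd n. of_nat d ^ (k - 1)))
   else 0)"

text \<open>A weight-homogeneous polynomial in G2, G4, G6 is given by its coefficient
  function on exponent triples (a,b,d) standing for G2^a G4^b G6^d.\<close>
definition qm_homog :: "nat \<Rightarrow> (nat \<times> nat \<times> nat \<Rightarrow> complex) \<Rightarrow> bool" where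
  "qm_homog w c \<longleftrightarrow> (\<forall>a b d. 2*a + 4*b + 6*d \<noteq> w \<longrightarrow> c (a, b, d) = 0)"

definition qm_eval :: "(nat \<times> nat \<times> nat \<Rightarrow> complex) \<Rightarrow> complex fps" where
  "qm_eval c = (\<Sum>x\<in>{x. c x \<noteq> 0}. case x of (a, b, d) \<Rightarrow>
      fps_const (c (a, b, d)) * G 2 ^ a * G 4 ^ b * G 6 ^ d)"

definition qm_dG2 :: "(nat \<times> nat \<times> nat \<Rightarrow> complex) \<Rightarrow> (nat \<times> nat \<times> nat \<Rightarrow> complex)" where
  "qm_dG2 c = (\<lambda>(a, b, d). of_nat (a + 1) * c (a + 1, b, d))"

text \<open>Weierstrass p-function as a formal Laurent series in z with q-series coefficients.\<close>
definition wp :: "complex fps fls" where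
  "wp = fls_X_intpow (-2) + fps_to_fls (Abs_fps (\<lambda>m.
          if m + 2 \<ge> 4 then fps_const (2 / of_nat (fact m)) * G (m + 2) else 0))"

definition wpm :: "complex fps fls" where
  "wpm = wp - fls_const (4 * G 2)"

definition sqrt_wpm :: "complex fps fls" where
  "sqrt_wpm = (THE S. S ^ 2 = wpm \<and> (\<forall>n < -1. fls_nth S n = 0) \<and> fls_nth S (-1) = 1 \<and> fls_nth S 0 = 0)"

definition odd_dfact :: "nat \<Rightarrow> nat" where
  "odd_dfact k = (\<Prod>i\<le>k. 2 * i + 1)"

definition A :: "nat \<Rightarrow> complex fps" where
  "A k = fps_const ((-1) ^ k / of_nat (odd_dfact k)) * fls_residue (wpm ^ k * sqrt_wpm)"

definition prop_a :: "(nat \<Rightarrow> complex fps) \<Rightarrow> bool" where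
  "prop_a F \<longleftrightarrow> (\<forall>k. \<exists>c. qm_homog (2 * k) c \<and> F k = qm_eval c \<and>
      qm_eval (qm_dG2 c) = 2 * (if k = 0 then 0 else F (k - 1)))"

definition prop_b :: "(nat \<Rightarrow> complex fps) \<Rightarrow> bool" where
  "prop_b F \<longleftrightarrow> (\<forall>n. \<exists>p :: complex poly. degree p = 2 * n \<and>
      (\<forall>k\<ge>n. fps_nth (F k) n = poly p (of_nat k) / ((-4) ^ k * of_nat (odd_dfact k))))"

definition prop_c :: "(nat \<Rightarrow> complex fps) \<Rightarrow> bool" where
  "prop_c F \<longleftrightarrow> fps_nth (F 0) 0 = 1"

end

theory Submission
  imports Defs
begin

text \<open>
  Let D = q d/dq. Liouville's elementary method, in the form of the partial fraction identity for
  u_a = q^a/(1 - q^a), gives G8 = 120 G4^2 and Ramanujan's identity Z^2 = wp - 4 G2 - 4 sum_k D(G_k) z^k/k!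
  for Z(z) = 1/z - 2 sum_k G_k z^(k-1)/(k-1)!. Comparing coefficients of z^k yields Ramanujan's differential
  equations and, inductively, that G_k lies in C[G4, G6] for every even k > 2. Hence each coefficient
  of (wp - 4 G2)^(1/2) is a weight-homogeneous polynomial in G2, G4, G6, and the chain rule gives (a).

  For (b), put T = coth(z/2) and y = cosh(z/2)^2. The series wp - 4 G2 is T^2/4 plus a series without
  constant term in q whose q^n-coefficient is a polynomial of degree at most n in y. Expanding the power
  k + 1/2 by the binomial series leaves the residues of T^(2m+1) y^i, which are 2 binom(m+i, i) because
  T' = (1 - T^2)/2 and y' = y/T.

  For uniqueness, G2 is algebraically independent of G4 and G6. With E2, E4, E6 the normalised series and
  r = E4^(1/2), x = E2/r, y = E6/r^3, the derivation (12/r) D acts on C[x, y] as the vector field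
  (2xy - x^2 - 1, 6(y^2 - 1)). A relation P(x, y) = 0 of least degree n in x, with leading coefficient of
  least degree in y, would satisfy dP + n x P = k(y) P for this vector field d; the invariant lines y = 1 and y = -1 force
  k(1) = n and k(-1) = -n, while the terms of highest weight force the slope of k to be at least 2 n. So
  n = 0, which is absurd as y is not constant. Thus two solutions of (a) whose members of index k - 1
  agree differ at index k by a modular form of weight 2k, and (b) makes it vanish to high order.
\<close>


section \<open>Lambert series\<close>

text \<open>Modular forms enter only as elements of C[G4, G6], that is, as formal q-series; no
  transformation law is used. Comparing coefficients in Ramanujan's identity expresses D(G_k) by
  G_(k+2) and products of two G's. For k = 2 and 4 this closes up, but for k = 6 it contains G8; the
  separate evaluation of G8 breaks the circle, and from then on the same identity is read backwards,
  as a recursion for G_(k+2). The operator d/dG2 acts on polynomials and not on q-series: existence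
  in (a) needs just one suitable polynomial, whereas uniqueness needs that a q-series determines its
  polynomial, which is why algebraic independence has to be proved. The variable y = cosh(z/2)^2 is
  chosen because the residue of T^(2m+1) y^i is then a polynomial in m of degree i; the degree 2 n
  in (b) is n from the binomial coefficient of k + 1/2 over n plus n from the residue.\<close>

definition lamb :: "nat \<Rightarrow> 'a::field fps" where
  "lamb a = Abs_fps (\<lambda>n. if 0 < n \<and> a dvd n then 1 else 0)"

lemma lamb_nth: "fps_nth (lamb a) n = (if 0 < n \<and> a dvd n then 1 else 0)"
  by (simp add: lamb_def)

lemma lamb_eq:
  assumes "a > 0"
  shows "lamb a * (1 - fps_X ^ a) = fps_X ^ a"
proof (rule fps_ext)
  fix n
  have "fps_nth (lamb a * (1 - fps_X ^ a)) n = fps_nth (lamb a) n - fps_nth (lamb a * fps_X ^ a) n"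
    by (simp add: algebra_simps)
  also have "\<dots> = fps_nth (fps_X ^ a) n"
    using assms by (auto simp: lamb_nth fps_X_power_mult_right_nth dvd_minus_self not_less dest: dvd_imp_le)
  finally show "fps_nth (lamb a * (1 - fps_X ^ a)) n = fps_nth (fps_X ^ a :: 'a fps) n" .
qed

lemma one_minus_X_power_nonzero: "a > 0 \<Longrightarrow> (1 - fps_X ^ a :: 'a::field fps) \<noteq> 0"
proof -
  assume "a > 0"
  then have "fps_nth (1 - fps_X ^ a :: 'a fps) 0 = 1" by (simp add: fps_X_power_nth)
  then show ?thesis by (metis fps_zero_nth zero_neq_one)
qed

text \<open>With A = q^a and B = q^b, clearing denominators leaves 1 - A B = (1 - A)(1 - B) + A (1 -
  B) + B (1 - A); power series over a field form a domain, so the denominators can be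
  cancelled.\<close>

lemma lamb_mult:
  assumes "a > 0" "b > 0"
  shows "lamb a * lamb b = lamb (a + b) * (1 + lamb a + lamb b)"
proof -
  define A B :: "'a fps" where "A = fps_X ^ a" and "B = fps_X ^ b"
  define u v w :: "'a fps" where "u = lamb a" "v = lamb b" "w = lamb (a + b)"
  have u: "u * (1 - A) = A" and v: "v * (1 - B) = B" and w: "w * (1 - A * B) = A * B"
    using lamb_eq[of a] lamb_eq[of b] lamb_eq[of "a+b"] assms
    by (simp_all add: A_def B_def u_v_w_def power_add)
  have nz: "(1 - A) * (1 - B) * (1 - A * B) \<noteq> 0"
    using one_minus_X_power_nonzero[of a] one_minus_X_power_nonzero[of b]
      one_minus_X_power_nonzero[of "a + b"] assms
    by (simp add: A_def B_def power_add)
  have "(u * v) * ((1 - A) * (1 - B) * (1 - A * B)) = (u * (1 - A)) * (v * (1 - B)) * (1 - A * B)"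
    by (simp add: algebra_simps)
  also have "\<dots> = A * B * (1 - A * B)" unfolding u v ..
  also have "\<dots> = (A * B) * ((1 - A) * (1 - B) + A * (1 - B) + B * (1 - A))"
    by (simp add: algebra_simps)
  also have "\<dots> = (w * (1 - A * B)) * ((1 - A) * (1 - B) + (u * (1 - A)) * (1 - B) + (v * (1 - B)) * (1 - A))"
    unfolding u v w ..
  also have "\<dots> = (w * (1 + u + v)) * ((1 - A) * (1 - B) * (1 - A * B))"
    by (simp add: algebra_simps)
  finally show ?thesis using nz by (simp add: u_v_w_def)
qed

text \<open>The product is divisible by q^(a + b). This cuts the square of pairs (a, b) down to the
  triangle on which (a, b) to (a, a + b) is a bijection.\<close>

lemma lamb_mult_nth_eq_0:
  assumes "n < a + b"
  shows "fps_nth (lamb a * lamb b) n = 0"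
proof -
  have "fps_nth (lamb a :: 'a fps) i * fps_nth (lamb b) (n - i) = 0" if "i \<le> n" for i
    using that assms by (auto simp: lamb_nth dest!: dvd_imp_le)
  then show ?thesis unfolding fps_mult_nth by (intro sum.neutral) simp
qed

text \<open>The coefficient counts the ways to write n as a sum of two positive multiples of a.
  These diagonal products are what \<open>lamb_liouville\<close> leaves over.\<close>

lemma lamb_square_nth:
  assumes "a > 0" "n > 0"
  shows "fps_nth (lamb a * lamb a) n = (if a dvd n then of_nat (n div a) - 1 else 0)"
proof (cases "a dvd n")
  case False
  have "fps_nth (lamb a :: 'a fps) i * fps_nth (lamb a) (n - i) = 0" if "i \<le> n" for i
    using that False assms by (auto simp: lamb_nth dest: dvd_diffD)
  then have "fps_nth (lamb a * lamb a :: 'a fps) n = 0" unfolding fps_mult_nth by (intro sum.neutral) simp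
  then show ?thesis using False by simp
next
  case True
  then obtain k where k: "n = a * k" by blast
  have "fps_nth (lamb a * lamb a) n = (\<Sum>i=0..n. if i \<in> (\<lambda>j. a * j) ` {0<..<k} then 1 else (0::'a))"
    unfolding fps_mult_nth
  proof (rule sum.cong[OF refl])
    fix i assume i: "i \<in> {0..n}"
    have "a dvd n - i \<longleftrightarrow> a dvd i" using i k by (metis atLeastAtMost_iff dvd_diff_nat dvd_triv_left diff_diff_cancel)
    then show "fps_nth (lamb a) i * fps_nth (lamb a) (n - i) = (if i \<in> (\<lambda>j. a * j) ` {0<..<k} then 1 else (0::'a))"
      using i k assms by (auto simp: lamb_nth image_iff)
  qed
  also have "\<dots> = of_nat (card ((\<lambda>j. a * j) ` {0<..<k}))"
  proof -
    have "(\<lambda>j. a * j) ` {0<..<k} \<subseteq> {0..n}" using k by auto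
    then show ?thesis by (simp add: sum.If_cases Int_absorb1)
  qed
  also have "card ((\<lambda>j. a * j) ` {0<..<k}) = k - 1"
    using assms by (subst card_image) (auto simp: inj_on_def)
  finally show ?thesis using True k assms by (simp add: of_nat_diff)
qed

text \<open>The partial fraction identity lamb_mult, summed over all pairs: the substitution
  (a, b) to (a, a + b) of Liouville's elementary method.\<close>
lemma lamb_double_sum:
  fixes h :: "nat \<Rightarrow> nat \<Rightarrow> 'a::field"
  assumes "n \<le> N"
  shows "(\<Sum>a=1..N. \<Sum>b=1..N. h a b * fps_nth (lamb a * lamb b) n) =
    (\<Sum>m=1..N. \<Sum>a=1..<m. h a (m - a) *
       (fps_nth (lamb m) n + fps_nth (lamb m * lamb a) n + fps_nth (lamb m * lamb (m - a)) n))"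
proof -
  define g where "g = (\<lambda>a b. h a b * fps_nth (lamb a * lamb b) n)"
  have "(\<Sum>a=1..N. \<Sum>b=1..N. g a b) = (\<Sum>p\<in>{1..N}\<times>{1..N}. g (fst p) (snd p))"
    by (simp add: sum.cartesian_product case_prod_beta)
  also have "\<dots> = (\<Sum>p\<in>{p\<in>{1..N}\<times>{1..N}. fst p + snd p \<le> N}. g (fst p) (snd p))"
  proof (rule sum.mono_neutral_right)
    show "\<forall>p\<in>{1..N} \<times> {1..N} - {p \<in> {1..N} \<times> {1..N}. fst p + snd p \<le> N}. g (fst p) (snd p) = 0"
      using assms by (auto simp: g_def not_le intro!: lamb_mult_nth_eq_0)
  qed auto
  also have "\<dots> = (\<Sum>p\<in>(SIGMA m:{1..N}. {1..<m}). g (snd p) (fst p - snd p))"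
    by (rule sum.reindex_bij_witness[of _ "\<lambda>(m,a). (a, m - a)" "\<lambda>(a,b). (a+b,a)"]) auto
  also have "\<dots> = (\<Sum>m=1..N. \<Sum>a=1..<m. g a (m - a))"
    by (subst sum.Sigma) (auto simp: case_prod_beta)
  also have "\<dots> = (\<Sum>m=1..N. \<Sum>a=1..<m. h a (m - a) *
       (fps_nth (lamb m) n + fps_nth (lamb m * lamb a) n + fps_nth (lamb m * lamb (m - a)) n))"
  proof (intro sum.cong refl)
    fix m a assume "m \<in> {1..N}" "a \<in> {1..<m}"
    then have "lamb a * lamb (m - a) = (lamb m + lamb m * lamb a + lamb m * lamb (m - a) :: 'a fps)"
      using lamb_mult[of a "m - a", where 'a='a] by (simp add: algebra_simps)
    then show "g a (m - a) = h a (m - a) *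
       (fps_nth (lamb m) n + fps_nth (lamb m * lamb a) n + fps_nth (lamb m * lamb (m - a)) n)"
      by (simp add: g_def)
  qed
  finally show ?thesis by (simp add: g_def)
qed

lemma sum_reflect_less:
  fixes f :: "nat \<Rightarrow> 'a::comm_monoid_add"
  shows "(\<Sum>a=1..<m. f (m - a)) = (\<Sum>a=1..<m. f a)"
  by (rule sum.reindex_bij_witness[of _ "\<lambda>a. m - a" "\<lambda>a. m - a"]) auto

lemma lamb_double_sum_sym:
  fixes h :: "nat \<Rightarrow> nat \<Rightarrow> 'a::field"
  assumes "n \<le> N" "\<And>a b. h a b = h b a"
  shows "(\<Sum>a=1..N. \<Sum>b=1..N. h a b * fps_nth (lamb a * lamb b) n) =
    (\<Sum>m=1..N. (\<Sum>a=1..<m. h a (m - a)) * fps_nth (lamb m) n) +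
    2 * (\<Sum>m=1..N. \<Sum>a=1..<m. h a (m - a) * fps_nth (lamb m * lamb a) n)"
proof -
  have *: "(\<Sum>a=1..<m. h a (m - a) * fps_nth (lamb m * lamb (m - a)) n) =
      (\<Sum>a=1..<m. h a (m - a) * fps_nth (lamb m * lamb a) n)" for m
  proof -
    have "(\<Sum>a=1..<m. h a (m - a) * fps_nth (lamb m * lamb (m - a)) n) =
      (\<Sum>a=1..<m. h (m - (m - a)) (m - a) * fps_nth (lamb m * lamb (m - a)) n)"
      by (intro sum.cong) auto
    also have "\<dots> = (\<Sum>a=1..<m. h (m - a) a * fps_nth (lamb m * lamb a) n)"
      by (rule sum_reflect_less)
    finally show ?thesis unfolding assms(2)[of "m - _"] .
  qed
  show ?thesis
    unfolding lamb_double_sum[OF assms(1)]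
    unfolding distrib_left sum.distrib * by (simp add: sum_distrib_right)
qed

lemma sum_square_split:
  fixes f :: "nat \<Rightarrow> nat \<Rightarrow> 'a::comm_monoid_add"
  shows "(\<Sum>a=1..N. \<Sum>b=1..N. f a b) = (\<Sum>a=1..N. f a a) + (\<Sum>m=1..N. \<Sum>a=1..<m. f m a + f a m)"
proof (induction N)
  case (Suc N)
  have "(\<Sum>a=1..Suc N. \<Sum>b=1..Suc N. f a b) =
      (\<Sum>a=1..N. \<Sum>b=1..N. f a b) + (\<Sum>a=1..N. f a (Suc N)) + (\<Sum>b=1..N. f (Suc N) b) + f (Suc N) (Suc N)"
    by (simp add: sum.distrib add_ac)
  then show ?case using Suc by (simp add: atLeastLessThanSuc_atLeastAtMost sum.distrib add_ac)
qed simp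

text \<open>With e(a, b) the coefficient of u_a u_b, the auxiliary sum of c(a) e(a, b) is evaluated
  twice: by splitting the square along its diagonal (S + P + R) and by the substitution (W + R + Q).
  The unwanted R cancels, and P - Q = W - S is all that is needed.\<close>

lemma lamb_liouville:
  fixes c :: "nat \<Rightarrow> 'a::field"
  assumes "n \<le> N"
  shows "(\<Sum>a=1..N. \<Sum>b=1..N. (c (a + b) - c (if a < b then b - a else a - b)) * fps_nth (lamb a * lamb b) n) =
    (\<Sum>m=1..N. (of_nat (m - 1) * c m + 2 * (\<Sum>a=1..<m. c a)) * fps_nth (lamb m) n)
    - (\<Sum>a=1..N. (2 * c a + c 0) * fps_nth (lamb a * lamb a) n)"
proof -
  let ?e = "\<lambda>a b. fps_nth (lamb a * lamb b :: 'a fps) n"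
  define P where "P = (\<Sum>m=1..N. \<Sum>a=1..<m. c m * ?e m a)"
  define Q where "Q = (\<Sum>m=1..N. \<Sum>a=1..<m. c (m - a) * ?e m a)"
  define R where "R = (\<Sum>m=1..N. \<Sum>a=1..<m. c a * ?e m a)"
  define S where "S = (\<Sum>a=1..N. c a * ?e a a)"
  define W where "W = (\<Sum>m=1..N. (\<Sum>a=1..<m. c a) * fps_nth (lamb m) n)"
  define V where "V = (\<Sum>m=1..N. (of_nat (m - 1) * c m) * fps_nth (lamb m) n)"
  define O' where "O' = (\<Sum>a=1..N. c 0 * ?e a a)"
  have e: "?e a b = ?e b a" for a b by (simp add: mult.commute)
  have 1: "(\<Sum>a=1..N. \<Sum>b=1..N. c (a + b) * ?e a b) = V + 2 * P"
  proof -
    have "(\<Sum>a=1..<m. c (a + (m - a))) = of_nat (m - 1) * c m" for m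
      by simp
    moreover have "(\<Sum>a=1..<m. c (a + (m - a)) * ?e m a) = (\<Sum>a=1..<m. c m * ?e m a)" for m
      by (intro sum.cong) auto
    ultimately show ?thesis
      using lamb_double_sum_sym[OF assms, of "\<lambda>a b. c (a + b)"] by (simp add: V_def P_def add.commute)
  qed
  have 2: "(\<Sum>a=1..N. \<Sum>b=1..N. c (if a < b then b - a else a - b) * ?e a b) = O' + 2 * Q"
  proof -
    have "(\<Sum>a=1..<m. c (if m < a then a - m else m - a) * ?e m a + c (if a < m then m - a else a - m) * ?e a m) =
        2 * (\<Sum>a=1..<m. c (m - a) * ?e m a)" for m
      unfolding sum_distrib_left by (intro sum.cong refl) (auto simp: e)
    then show ?thesis
      by (subst sum_square_split) (simp add: O'_def Q_def sum_distrib_left)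
  qed
  have 3: "(\<Sum>a=1..N. \<Sum>b=1..N. c a * ?e a b) = S + P + R"
    by (subst sum_square_split) (simp add: S_def P_def R_def sum.distrib e)
  have 4: "(\<Sum>a=1..N. \<Sum>b=1..N. c a * ?e a b) = W + R + Q"
  proof -
    have "(\<Sum>a=1..<m. c a * ?e m (m - a)) = (\<Sum>a=1..<m. c (m - a) * ?e m a)" for m
      using sum_reflect_less[of "\<lambda>a. c (m - a) * ?e m a" m]
      by (metis (no_types, lifting) atLeastLessThan_iff diff_diff_cancel less_imp_le sum.cong)
    then show ?thesis
      unfolding lamb_double_sum[OF assms] W_def R_def Q_def
      by (simp add: distrib_left sum.distrib sum_distrib_right)
  qed
  from 3 4 have 5: "S + P = W + Q" by simp
  have "V + 2 * P - (O' + 2 * Q) = V + 2 * W - (2 * S + O')"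
  proof -
    have "P - Q = W - S" using 5 by (simp add: algebra_simps)
    then have "2 * (P - Q) = 2 * (W - S)" by simp
    then show ?thesis by (simp add: algebra_simps)
  qed
  moreover have "(\<Sum>a=1..N. \<Sum>b=1..N. (c (a + b) - c (if a < b then b - a else a - b)) * ?e a b) =
      V + 2 * P - (O' + 2 * Q)"
    by (simp add: left_diff_distrib sum_subtractf 1[symmetric] 2[symmetric])
  moreover have "(\<Sum>m=1..N. (of_nat (m - 1) * c m + 2 * (\<Sum>a=1..<m. c a)) * fps_nth (lamb m) n) = V + 2 * W"
    unfolding V_def W_def by (simp only: distrib_right sum.distrib sum_distrib_left[of 2, symmetric] mult.assoc)
  moreover have "(\<Sum>a=1..N. (2 * c a + c 0) * ?e a a) = 2 * S + O'"
    unfolding S_def O'_def sum_distrib_left by (simp add: distrib_right sum.distrib mult.assoc)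
  ultimately show ?thesis by metis
qed

lemma fps_mult_nth_cong:
  assumes "\<And>i. i \<le> n \<Longrightarrow> fps_nth f i = fps_nth f' i" "\<And>i. i \<le> n \<Longrightarrow> fps_nth g i = fps_nth g' i"
  shows "fps_nth (f * g) n = fps_nth (f' * g') n"
  unfolding fps_mult_nth using assms by (intro sum.cong) auto

text \<open>The coefficients come from an arbitrary field: they are complex numbers in
  \<open>lambert_cube_square\<close> and Laurent series in z in
  \<open>zeta_fls_square\<close>.\<close>

definition lambert_series :: "(nat \<Rightarrow> 'a::field) \<Rightarrow> 'a fps" where
  "lambert_series c = Abs_fps (\<lambda>n. if n = 0 then 0 else (\<Sum>d | d dvd n. c d))"

lemma lambert_series_nth:
  assumes "n \<le> N"
  shows "fps_nth (lambert_series c) n = (\<Sum>a=1..N. c a * fps_nth (lamb a) n)"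
proof (cases "n = 0")
  case False
  have "(\<Sum>a=1..N. c a * fps_nth (lamb a) n) = (\<Sum>a=1..N. if a dvd n then c a else 0)"
    using False by (intro sum.cong) (auto simp: lamb_nth)
  also have "\<dots> = (\<Sum>a\<in>{1..N} \<inter> {a. a dvd n}. c a)"
    by (simp add: sum.If_cases)
  also have "{1..N} \<inter> {a. a dvd n} = {a. a dvd n}"
    using False assms by (auto simp: Suc_le_eq intro!: gr0I dest: order_trans[OF dvd_imp_le])
  finally show ?thesis using False by (simp add: lambert_series_def)
qed (simp add: lambert_series_def lamb_nth)

lemma lambert_series_mult_nth:
  assumes "n \<le> N"
  shows "fps_nth (lambert_series c * lambert_series c') n =
    (\<Sum>a=1..N. \<Sum>b=1..N. c a * c' b * fps_nth (lamb a * lamb b) n)"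
proof -
  define L where "L = (\<lambda>c::nat \<Rightarrow> 'a. \<Sum>a=1..N. fps_const (c a) * lamb a)"
  have "fps_nth (lambert_series c) i = fps_nth (L c) i" if "i \<le> n" for i c
    using lambert_series_nth[of i N c] that assms by (simp add: L_def fps_sum_nth)
  then have "fps_nth (lambert_series c * lambert_series c') n = fps_nth (L c * L c') n"
    by (intro fps_mult_nth_cong) auto
  also have "L c * L c' = (\<Sum>a=1..N. \<Sum>b=1..N. fps_const (c a * c' b) * (lamb a * lamb b))"
    by (simp add: L_def sum_product algebra_simps flip: fps_const_mult)
  finally show ?thesis by (simp add: fps_sum_nth)
qed

lemma sum_squares_reflect:
  "(\<Sum>a=1..<m. of_nat a ^ 2 * of_nat (m - a) ^ 2 :: complex) = (of_nat m ^ 5 - of_nat m) / 30"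
proof -
  \<comment> \<open>An independent x in place of \<open>m\<close> in the summand makes the sum
    inductive in its upper limit; the right-hand side is assembled from the power sums of exponents
    2, 3 and 4.\<close>
  have "(\<Sum>a=1..<m. of_nat a ^ 2 * (x - of_nat a) ^ 2 :: complex) =
     (x ^ 2 * (of_nat m * (of_nat m - 1) * (2 * of_nat m - 1) / 6)
      - 2 * x * (of_nat m * (of_nat m - 1) / 2) ^ 2
      + of_nat m * (of_nat m - 1) * (2 * of_nat m - 1) * (3 * of_nat m ^ 2 - 3 * of_nat m - 1) / 30)" for x
  proof (induction m)
    case (Suc m)
    show ?case
    proof (cases "m = 0")
      case False
      then have "(\<Sum>a=1..<Suc m. of_nat a ^ 2 * (x - of_nat a) ^ 2 :: complex) =
          (\<Sum>a=1..<m. of_nat a ^ 2 * (x - of_nat a) ^ 2) + of_nat m ^ 2 * (x - of_nat m) ^ 2"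
        by simp
      then show ?thesis unfolding Suc by (simp add: field_simps power2_eq_square power3_eq_cube power4_eq_xxxx)
    qed simp
  qed simp
  note * = this[of "of_nat m"]
  have "(\<Sum>a=1..<m. of_nat a ^ 2 * of_nat (m - a) ^ 2 :: complex) =
      (\<Sum>a=1..<m. of_nat a ^ 2 * (of_nat m - of_nat a) ^ 2)"
    by (intro sum.cong) (auto simp: of_nat_diff)
  also have "\<dots> = (of_nat m ^ 5 - of_nat m) / 30"
    unfolding * by (simp add: field_simps eval_nat_numeral)
  finally show ?thesis .
qed

text \<open>The weight (a b (a + b))^2 is invariant under the substitutions behind
  lamb_double_sum, and h(a,b) - h(a,-b) = 4 a^3 b^3.\<close>
lemma lambert_cube_square:
  "120 * (lambert_series (\<lambda>d. of_nat d ^ 3) * lambert_series (\<lambda>d. of_nat d ^ 3)) =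
    (lambert_series (\<lambda>d. of_nat d ^ 7) - lambert_series (\<lambda>d. of_nat d ^ 3) :: complex fps)"
proof (rule fps_ext)
  fix n
  let ?e = "\<lambda>a b. fps_nth (lamb a * lamb b :: complex fps) n"
  define D where "D = (\<Sum>m=1..n. \<Sum>a=1..<m. (of_nat (a * m * (m - a))) ^ 2 * ?e m a)"
  define h where "h = (\<lambda>a b. (of_nat (a * b * (a + b)) :: complex) ^ 2)"
  have 1: "(\<Sum>a=1..n. \<Sum>b=1..n. h a b * ?e a b) =
      (\<Sum>m=1..n. (of_nat m ^ 7 - of_nat m ^ 3) / 30 * fps_nth (lamb m) n) + 2 * D"
  proof -
    have A: "(\<Sum>a=1..<m. h a (m - a)) = (of_nat m ^ 7 - of_nat m ^ 3) / 30" for m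
    proof -
      have "(\<Sum>a=1..<m. h a (m - a)) = of_nat m ^ 2 * (\<Sum>a=1..<m. of_nat a ^ 2 * of_nat (m - a) ^ 2)"
        unfolding sum_distrib_left by (intro sum.cong refl) (auto simp: h_def power_mult_distrib)
      then show ?thesis unfolding sum_squares_reflect by (simp add: field_simps eval_nat_numeral)
    qed
    have B: "(\<Sum>m=1..n. \<Sum>a=1..<m. h a (m - a) * ?e m a) = D"
      unfolding D_def by (intro sum.cong refl) (auto simp: h_def algebra_simps)
    have "h a b = h b a" for a b :: nat by (simp add: h_def add.commute mult.commute)
    from lamb_double_sum_sym[of n n h, OF order_refl this] show ?thesis unfolding A B .
  qed
  \<comment> \<open>The diagonal vanishes because of the factor a - b, and both halves of the square
    contribute \<open>D\<close>; so \<open>D\<close> drops out of the difference with the first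
    evaluation.\<close>
  have 2: "(\<Sum>a=1..n. \<Sum>b=1..n. (h a b - 4 * (of_nat a ^ 3 * of_nat b ^ 3)) * ?e a b) = 2 * D"
  proof -
    have *: "h a b - 4 * (of_nat a ^ 3 * of_nat b ^ 3) = (of_nat a * of_nat b * (of_nat a - of_nat b)) ^ 2" for a b
      by (simp add: h_def algebra_simps eval_nat_numeral)
    have **: "(of_nat m * of_nat a * (of_nat m - of_nat a)) ^ 2 * ?e m a + (of_nat a * of_nat m * (of_nat a - of_nat m)) ^ 2 * ?e a m =
       2 * ((of_nat (a * m * (m - a))) ^ 2 * ?e m a)" if "a < m" for a m
      using that by (simp add: of_nat_diff power2_eq_square algebra_simps)
    show ?thesis
      unfolding D_def sum_distrib_left * sum_square_split by (simp add: **)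
  qed
  have "4 * fps_nth (lambert_series (\<lambda>d. of_nat d ^ 3) * lambert_series (\<lambda>d. of_nat d ^ 3)) n =
     (\<Sum>a=1..n. \<Sum>b=1..n. h a b * ?e a b) - (\<Sum>a=1..n. \<Sum>b=1..n. (h a b - 4 * (of_nat a ^ 3 * of_nat b ^ 3)) * ?e a b)"
    by (simp add: lambert_series_mult_nth[of n n] left_diff_distrib sum_subtractf sum_distrib_left mult.assoc)
  also have "\<dots> = (\<Sum>m=1..n. (of_nat m ^ 7 - of_nat m ^ 3) / 30 * fps_nth (lamb m) n)"
    unfolding 1 2 by simp
  also have "\<dots> = (fps_nth (lambert_series (\<lambda>d. of_nat d ^ 7)) n - fps_nth (lambert_series (\<lambda>d. of_nat d ^ 3)) n) / 30"
    by (simp add: lambert_series_nth[of n n] sum_subtractf sum_divide_distrib left_diff_distrib diff_divide_distrib)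
  finally show "fps_nth (120 * (lambert_series (\<lambda>d. of_nat d ^ 3) * lambert_series (\<lambda>d. of_nat d ^ 3))) n =
    fps_nth (lambert_series (\<lambda>d. of_nat d ^ 7) - lambert_series (\<lambda>d. of_nat d ^ 3) :: complex fps) n"
    by (simp add: numeral_fps_const)
qed

section \<open>Bernoulli numbers and the constant terms of G_k\<close>

definition bern :: "complex fps" where "bern = fps_X / (fps_exp 1 - 1)"

lemma bern_mult: "bern * (fps_exp 1 - 1) = fps_X"
proof -
  have s: "subdegree (fps_exp 1 - 1 :: complex fps) = 1"
    by (rule subdegreeI) auto
  have "(fps_exp 1 - 1 :: complex fps) dvd fps_X"
    by (subst fps_dvd_iff) (use s in auto)
  then show ?thesis by (simp add: bern_def)
qed

lemma bern_rec:
  "fps_nth bern n = (if n = 0 then 1 else - (\<Sum>i<n. fps_nth bern i / fact (Suc n - i)))"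
proof -
  have "fps_nth (bern * (fps_exp 1 - 1)) (Suc n) = (\<Sum>i\<le>Suc n. fps_nth bern i * fps_nth (fps_exp 1 - 1) (Suc n - i))"
    by (simp add: fps_mult_nth atMost_atLeast0)
  also have "\<dots> = (\<Sum>i\<le>n. fps_nth bern i / fact (Suc n - i))"
    by (auto intro!: sum.cong)
  also have "\<dots> = (\<Sum>i<n. fps_nth bern i / fact (Suc n - i)) + fps_nth bern n"
    by (simp flip: lessThan_Suc_atMost)
  finally show ?thesis by (auto simp: bern_mult eq_neg_iff_add_eq_0 add.commute)
qed

text \<open>The substitution X to -X turns X/(e^X - 1) into itself plus X, so all odd coefficients
  except that of X vanish.\<close>

lemma bern_odd: assumes "odd n" "n \<noteq> 1" shows "fps_nth bern n = 0"
proof -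
  define b' where "b' = bern oo (- fps_X)"
  have "b' * ((fps_exp 1 oo (- fps_X)) - 1) = (fps_X oo (- fps_X))"
    unfolding b'_def bern_mult[symmetric] 
    by (simp add: fps_compose_mult_distrib fps_compose_sub_distrib)
  then have "b' * (fps_exp (-1) - 1) = - fps_X"
    by simp
  then have "b' * (fps_exp (-1) - 1) * fps_exp 1 = - fps_X * fps_exp 1"
    by simp
  moreover have "fps_exp (-1) * fps_exp 1 = (1 :: complex fps)"
    by (simp flip: fps_exp_add_mult)
  ultimately have "b' * (fps_exp 1 - 1) = fps_X * fps_exp 1"
    by (simp add: algebra_simps)
  also have "\<dots> = (bern + fps_X) * (fps_exp 1 - 1)"
    using bern_mult by (simp add: algebra_simps)
  finally have "b' = bern + fps_X"
    by (metis bern_mult fps_X_neq_zero mult_right_cancel mult_zero_right)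
  moreover have "fps_nth b' n = (-1) ^ n * fps_nth bern n"
    by (simp add: b'_def fps_compose_uminus')
  ultimately show ?thesis using assms by (simp add: fps_X_nth)
qed

lemma bern_values: "fps_nth bern 0 = 1" "fps_nth bern 2 = 1/12" "fps_nth bern 4 = -1/720"
  "fps_nth bern 6 = 1/30240" "fps_nth bern 8 = -1/1209600"
proof -
  have 0: "fps_nth bern 0 = 1" by (subst bern_rec) simp
  have 1: "fps_nth bern (Suc 0) = -1/2" by (subst bern_rec) (use 0 in \<open>simp add: eval_nat_numeral lessThan_Suc\<close>)
  have set: "{..<4} = {0,1,2,3::nat}" "{..<6} = {0,1,2,3,4,5::nat}" "{..<8} = {0,1,2,3,4,5,6,7::nat}" by auto
  have odd: "fps_nth bern 3 = 0" "fps_nth bern 5 = 0" "fps_nth bern 7 = 0" by (simp_all add: bern_odd)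
  show 2: "fps_nth bern 2 = 1/12" by (subst bern_rec) (use 0 1 odd in \<open>simp add: eval_nat_numeral lessThan_Suc\<close>)
  show 4: "fps_nth bern 4 = -1/720" by (subst bern_rec) (simp add: set 0 1 2 odd fact_numeral)
  show 6: "fps_nth bern 6 = 1/30240" by (subst bern_rec) (simp add: set 0 1 2 4 odd fact_numeral)
  show 8: "fps_nth bern 8 = -1/1209600" by (subst bern_rec) (simp add: set 0 1 2 4 6 odd fact_numeral)
  show "fps_nth bern 0 = 1" by fact
qed

lemma G_eq:
  assumes "even k" "k \<ge> 2"
  shows "G k = fps_const (- fact (k - 1) / 2 * fps_nth bern k) + lambert_series (\<lambda>d. of_nat d ^ (k - 1))"
proof -
  have "fact k = (of_nat k * fact (k - 1) :: complex)" using assms by (subst fact_reduce) auto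
  then show ?thesis using assms
    by (intro fps_ext) (auto simp: G_def bernoulli_def bern_def[symmetric] lambert_series_def)
qed

lemma G_odd: "odd k \<Longrightarrow> G k = 0" by (simp add: G_def)

lemma G2_eq: "G 2 = fps_const (-1/24) + lambert_series (\<lambda>d. of_nat d)"
  by (simp add: G_eq bern_values)
lemma G4_eq: "G 4 = fps_const (1/240) + lambert_series (\<lambda>d. of_nat d ^ 3)"
  by (simp add: G_eq bern_values fact_numeral)
lemma G6_eq: "G 6 = fps_const (-1/504) + lambert_series (\<lambda>d. of_nat d ^ 5)"
  by (simp add: G_eq bern_values fact_numeral)

text \<open>In 120 (1/240 + L)^2, with L the Lambert series of d^3, the cross term is L and cancels
  the -L that \<open>lambert_cube_square\<close> gives for 120 L^2; the constant 120/240^2 = 1/480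
  is that of G8.\<close>

lemma G8_eq: "G 8 = 120 * G 4 ^ 2"
proof -
  have c: "fps_const (1/480) = 120 * fps_const (1/240 :: complex) ^ 2" "240 * fps_const (1/240 :: complex) = 1"
    by (simp_all add: numeral_fps_const fps_const_power power2_eq_square)
  have "G 8 = fps_const (1/480) + lambert_series (\<lambda>d. of_nat d ^ 7)"
    by (simp add: G_eq bern_values fact_numeral)
  moreover have "lambert_series (\<lambda>d. of_nat d ^ 7 :: complex) = 
     240 * fps_const (1/240) * lambert_series (\<lambda>d. of_nat d ^ 3) + 120 * (lambert_series (\<lambda>d. of_nat d ^ 3) * lambert_series (\<lambda>d. of_nat d ^ 3))"
    unfolding lambert_cube_square c by simp
  ultimately show ?thesis unfolding G4_eq c by (simp add: power2_eq_square algebra_simps)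
qed

section \<open>Ramanujan's differential equations\<close>

text \<open>Regards a Laurent series in z over q-series as a q-series over Laurent series in z,
  where closed forms such as coth(z/2) live. The pole order in z bounds that of every q-coefficient,
  so \<open>Abs_fls\<close> is legitimate.\<close>

definition qswap :: "complex fps fls \<Rightarrow> complex fls fps" where
  "qswap f = Abs_fps (\<lambda>n. Abs_fls (\<lambda>m. fps_nth (fls_nth f m) n))"

lemma qswap_nth: "fls_nth (fps_nth (qswap f) n) m = fps_nth (fls_nth f m) n"
  unfolding qswap_def fps_nth_Abs_fps
  by (rule nth_Abs_fls_lower_bound[of "fls_subdegree f"]) auto

lemma qswap_eq_iff: "qswap f = qswap g \<longleftrightarrow> f = g"
  by (metis fls_eqI fps_ext qswap_nth)

text \<open>The q-coefficients of one series have different subdegrees in z; summing over a common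
  range lets their convolutions be compared.\<close>

lemma fls_mult_nth_bounded:
  fixes f g :: "'a::{comm_monoid_add, mult_zero} fls"
  assumes "\<And>i. i < a \<Longrightarrow> fls_nth f i = 0" "\<And>i. i < b \<Longrightarrow> fls_nth g i = 0"
  shows "fls_nth (f * g) n = (\<Sum>i=a..n - b. fls_nth f i * fls_nth g (n - i))"
proof -
  define a' b' where "a' = min a (fls_subdegree f)" and "b' = min b (fls_subdegree g)"
  have "fls_nth (f * g) n = (\<Sum>i=fls_subdegree f..n - fls_subdegree g. fls_nth f i * fls_nth g (n - i))"
    by (rule fls_times_nth(2))
  also have "\<dots> = (\<Sum>i=a'..n - b'. fls_nth f i * fls_nth g (n - i))"
    by (rule sum.mono_neutral_left) (auto simp: a'_def b'_def not_le intro!: fls_eq0_below_subdegree)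
  also have "\<dots> = (\<Sum>i=a..n - b. fls_nth f i * fls_nth g (n - i))"
    by (rule sum.mono_neutral_right) (auto simp: a'_def b'_def assms not_le)
  finally show ?thesis .
qed

lemma fls_sum_nth: "fls_nth (sum f I) n = (\<Sum>i\<in>I. fls_nth (f i) n)"
  by (induction I rule: infinite_finite_induct) auto

lemma qswap_diff: "qswap (f - g) = qswap f - qswap g"
  by (intro fps_ext fls_eqI) (simp add: qswap_nth)
lemma qswap_1: "qswap 1 = 1"
  by (intro fps_ext fls_eqI) (simp add: qswap_nth)
lemma qswap_mult: "qswap (f * g) = qswap f * qswap g"
proof (intro fps_ext fls_eqI)
  fix n m
  let ?a = "fls_subdegree f" and ?b = "fls_subdegree g"
  have "fls_nth (fps_nth (qswap f * qswap g) n) m =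
      (\<Sum>i=0..n. \<Sum>j=?a..m - ?b. fps_nth (fls_nth f j) i * fps_nth (fls_nth g (m - j)) (n - i))"
    unfolding fps_mult_nth fls_sum_nth
    by (intro sum.cong refl, subst fls_mult_nth_bounded[of ?a _ ?b]) (auto simp: qswap_nth)
  also have "\<dots> = fps_nth (fls_nth (f * g) m) n"
    unfolding fls_times_nth(2)[of f g] fps_sum_nth fps_mult_nth by (rule sum.swap)
  finally show "fls_nth (fps_nth (qswap (f * g)) n) m = fls_nth (fps_nth (qswap f * qswap g) n) m"
    by (simp add: qswap_nth)
qed
lemma qswap_power: "qswap (f ^ n) = qswap f ^ n"
  by (induction n) (auto simp: qswap_1 qswap_mult)

section \<open>Hyperbolic functions of z and the q-expansions of zeta and wp\<close>

definition ez :: "complex \<Rightarrow> complex fls" where "ez t = fps_to_fls (fps_exp t)"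
text \<open>As \<open>ez t\<close> is e^(t z), \<open>chz d\<close> and \<open>shz d\<close> are 2
  cosh(d z) and 2 sinh(d z).\<close>

definition chz :: "nat \<Rightarrow> complex fls" where "chz d = ez (of_nat d) + ez (- of_nat d)"
definition shz :: "nat \<Rightarrow> complex fls" where "shz d = ez (of_nat d) - ez (- of_nat d)"
text \<open>coth(z/2)\<close>
definition cothz :: "complex fls" where "cothz = (ez 1 + 1) / (ez 1 - 1)"

lemma ez_add: "ez (a + b) = ez a * ez b"
  by (simp add: ez_def fps_exp_add_mult fls_times_fps_to_fls)
lemma ez_0: "ez 0 = 1" by (simp add: ez_def)
lemma ez_deriv: "fls_deriv (ez a) = fls_const a * ez a"
  by (simp add: ez_def fls_deriv_fps_to_fls fls_times_fps_to_fls flip: fps_const_to_fls)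
lemma ez1_neq_1: "ez 1 - 1 \<noteq> 0"
proof
  assume "ez 1 - 1 = 0"
  then have "fls_nth (ez 1 - 1) 1 = 0" by (metis fls_zero_nth)
  then show False by (simp add: ez_def)
qed

lemma cothz_deriv: "fls_deriv cothz = - (cothz ^ 2 - 1) / 2"
proof -
  let ?e = "ez 1"
  have "cothz * (?e - 1) = ?e + 1" using ez1_neq_1 by (simp add: cothz_def)
  then have "fls_deriv (cothz * (?e - 1)) = fls_deriv (?e + 1)" by simp
  then have "cothz * ?e + fls_deriv cothz * (?e - 1) = ?e"
    by (simp add: ez_deriv)
  with \<open>cothz * (?e - 1) = ?e + 1\<close> have "(2 * fls_deriv cothz) * (?e - 1) = - (cothz ^ 2 - 1) * (?e - 1)"
    by algebra
  then have "2 * fls_deriv cothz = - (cothz ^ 2 - 1)" using ez1_neq_1 by (metis mult_right_cancel)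
  then show ?thesis by (simp add: field_simps)
qed

text \<open>The product formula for sinh, in the shape required by \<open>lamb_liouville\<close>
  with c = \<open>chz\<close>; cosh is even, so |a - b| may stand for a - b.\<close>

lemma shz_mult: "shz a * shz b = chz (a + b) - chz (if a < b then b - a else a - b)"
proof -
  have "ez (of_nat a) * ez (- of_nat b) = ez (of_nat a - of_nat b)" for a b :: nat
    by (simp flip: ez_add)
  moreover have "ez (- of_nat a) * ez (of_nat b) = ez (of_nat b - of_nat a)" for a b :: nat
    by (simp flip: ez_add)
  moreover have "ez (- of_nat a) * ez (- of_nat b) = ez (- of_nat (a + b))" for a b :: nat
    by (simp flip: ez_add)
  moreover have "ez (of_nat a) * ez (of_nat b) = ez (of_nat (a + b))" for a b :: nat
    by (simp flip: ez_add)
  ultimately show ?thesis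
    by (simp add: shz_def chz_def algebra_simps of_nat_diff)
qed

text \<open>After multiplication by e^z - 1 the sum telescopes, as for the Dirichlet kernel. It
  serves to cancel the sums of \<open>chz l\<close> that \<open>lamb_liouville\<close>
  produces.\<close>

lemma cothz_shz: assumes "d > 0" shows "cothz * shz d = chz d + chz 0 + 2 * (\<Sum>l=1..<d. chz l)"
proof -
  let ?e = "ez 1"
  have ei: "ez (-1) * ?e = 1" by (simp add: ez_0 flip: ez_add)
  have S: "ez (of_nat (Suc d)) = ?e * ez (of_nat d)" "ez (- of_nat (Suc d)) = ez (-1) * ez (- of_nat d)" for d
    by (simp_all flip: ez_add add: algebra_simps)
  have "(?e + 1) * shz d = (chz d + chz 0 + 2 * (\<Sum>l=1..<d. chz l)) * (?e - 1)"
    using assms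
  proof (induction d rule: nat_induct_non_zero)
    case 1
    show ?case using ei by (simp add: shz_def chz_def ez_0 algebra_simps)
  next
    case (Suc d)
    have "(chz (Suc d) + chz 0 + 2 * (\<Sum>l=1..<Suc d. chz l)) * (?e - 1) =
       (chz d + chz 0 + 2 * (\<Sum>l=1..<d. chz l)) * (?e - 1) + (chz (Suc d) + chz d) * (?e - 1)"
      using Suc by (simp add: algebra_simps)
    also have "\<dots> = (?e + 1) * shz d + (chz (Suc d) + chz d) * (?e - 1)"
      using Suc.IH by simp
    also have "\<dots> = (?e + 1) * shz (Suc d) + 2 * ((ez (-1) * ?e) - 1) * ez (- of_nat d)"
      unfolding shz_def chz_def S by (simp add: algebra_simps)
    finally show ?case using ei by simp
  qed
  then show ?thesis using ez1_neq_1 by (simp add: cothz_def field_simps)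
qed

text \<open>The Weierstrass zeta function minus 2 G2 z; this linear term makes its q-expansion a
  Lambert series in sinh(d z) with leading term coth(z/2)/2.\<close>

definition zeta_fls :: "complex fps fls" where
  "zeta_fls = fls_X_inv - fps_to_fls (Abs_fps (\<lambda>m. fps_const (2 / fact m) * G (m + 1)))"

definition DG_fls :: "complex fps fls" where
  "DG_fls = fps_to_fls (Abs_fps (\<lambda>k. fps_const (1 / fact k) * (fps_X * fps_deriv (G k))))"

lemma G_nth_pos: "n > 0 \<Longrightarrow> fps_nth (G k) n = (if even k \<and> k \<ge> 2 then (\<Sum>d | d dvd n. of_nat d ^ (k - 1)) else 0)"
  by (simp add: G_def)

lemma G_nth_0: "fps_nth (G k) 0 = (if even k \<and> k \<ge> 2 then - fact (k - 1) / 2 * fps_nth bern k else 0)"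
  by (cases "even k \<and> k \<ge> 2") (simp add: G_eq lambert_series_def, auto simp: G_def)

lemma cothz_bern: "cothz = 1 + 2 * fls_shift 1 (fps_to_fls bern)"
proof -
  have "fls_shift 1 (fps_to_fls bern) * (ez 1 - 1) = fls_shift 1 (fps_to_fls (bern * (fps_exp 1 - 1)))"
    by (simp add: ez_def fls_times_fps_to_fls fls_shifted_times_simps)
  also have "\<dots> = 1" by (simp add: bern_mult)
  finally have "fls_shift 1 (fps_to_fls bern) = 1 / (ez 1 - 1)"
    using ez1_neq_1 by (simp add: field_simps)
  then show ?thesis using ez1_neq_1 by (simp add: cothz_def field_simps)
qed

lemma ez_nth: "fls_nth (ez t) m = (if m < 0 then 0 else t ^ nat m / fact (nat m))"
  by (simp add: ez_def)

text \<open>At q^0 this is the Bernoulli expansion of coth(z/2)/2; at higher powers of q it is the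
  Taylor expansion of sinh(d z), whose missing even powers match G_k = 0 for odd k.\<close>

lemma qswap_zeta: "qswap zeta_fls = fps_const (cothz / 2) - lambert_series shz"
proof (intro fps_ext fls_eqI)
  fix n m
  show "fls_nth (fps_nth (qswap zeta_fls) n) m = fls_nth (fps_nth (fps_const (cothz / 2) - lambert_series shz) n) m"
  proof (cases "n = 0")
    case True
    have h: "cothz / 2 = fls_const (1/2) + fls_shift 1 (fps_to_fls bern)"
      unfolding cothz_bern by (simp add: add_divide_distrib flip: fls_const_1) (simp add: fls_eq_iff)
    consider "m < -1" | "m = -1" | "m = 0" | "m > 0" by linarith
    then show ?thesis
    proof cases
      case 3
      have "fps_nth bern (Suc 0) = -1/2"
        by (subst bern_rec) (simp add: bern_values eval_nat_numeral)
      then show ?thesis using True 3 by (simp add: qswap_nth zeta_fls_def h lambert_series_def G_nth_0)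
    next
      case 4
      then obtain k where "m = int k" "k > 0" by (metis pos_int_cases)
      then show ?thesis using True bern_odd[of "Suc k"]
        by (auto simp: qswap_nth zeta_fls_def h lambert_series_def G_nth_0 nat_add_distrib)
    qed (use True in \<open>auto simp: qswap_nth zeta_fls_def h lambert_series_def G_nth_0 bern_values\<close>)
  next
    case False
    show ?thesis
    proof (cases "m < 0")
      case True
      then show ?thesis using False
        by (auto simp: qswap_nth zeta_fls_def lambert_series_def fls_sum_nth shz_def ez_nth)
    next
      case m: False
      then obtain k where "m = int k" using nonneg_int_cases by (metis not_less)
      then show ?thesis using False
        by (cases "even k") (auto simp: qswap_nth zeta_fls_def lambert_series_def fls_sum_nth shz_def ez_nth G_nth_pos
             sum_distrib_left sum_divide_distrib simp flip: sum_negf dest: odd_pos intro!: sum.cong)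
    qed
  qed
qed

text \<open>The 6 is 4 from wp - 4 G2 plus 2 from the linear term of
  \<open>zeta_fls\<close>.\<close>

lemma wpm_zeta: "wpm = - fls_deriv zeta_fls - fls_const (6 * G 2)"
proof (rule fls_eqI)
  fix m :: int
  have G1: "G (Suc 0) = 0" by (simp add: G_def)
  have G3: "G 3 = 0" by (simp add: G_def)
  have G2: "G 2 * fps_const 6 = G (Suc (Suc 0)) * fps_const 2 + G 2 * fps_const 4"
    by (simp flip: distrib_left add: numeral_2_eq_2[symmetric])
  consider "m < -2" | "m = -2" | "m = -1" | "m = 0" | "m = 1" | "m > 1" by linarith
  then show "fls_nth wpm m = fls_nth (- fls_deriv zeta_fls - fls_const (6 * G 2)) m"
  proof cases
    case 6
    then obtain k where k: "m = int k" "k > 1" by (metis nonneg_int_cases less_imp_le of_nat_1 of_nat_less_iff zero_less_one order_less_trans)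
    have e: "of_int (int k + 1) = fps_const (of_nat (Suc k) :: complex)"
      using fps_of_nat[of "Suc k", where 'a=complex] by simp
    have "of_nat k + 1 \<noteq> (0::complex)" by (metis of_nat_Suc of_nat_eq_0_iff nat.distinct(1) add.commute)
    then have "fps_const (of_nat (Suc k)) * fps_const (2 / fact (Suc k)) = fps_const (2 / fact k :: complex)"
      by (simp add: divide_simps) (simp add: algebra_simps)
    then show ?thesis using k
      by (simp add: wpm_def wp_def zeta_fls_def nat_add_distrib e del: of_nat_Suc fps_const_mult fact_Suc of_int_add
          flip: mult.assoc)
  qed (auto simp: wpm_def wp_def zeta_fls_def G1 G2 G3 numeral_fps_const algebra_simps)
qed

text \<open>With T = coth(z/2), minus the derivative of T/2 is (T^2 - 1)/4, and the constant term
  1/4 of -6 G2 completes it to T^2/4; thus the shift by 4 G2 makes the q^0 part a square.\<close>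

lemma qswap_wpm: "qswap wpm = fps_const (cothz ^ 2 / 4) + lambert_series (\<lambda>d. of_nat d * (chz d - 6))"
proof (rule fps_ext)
  fix n
  have d: "fps_nth (qswap (fls_deriv f)) n = fls_deriv (fps_nth (qswap f) n)" for f
    by (rule fls_eqI) (simp add: qswap_nth fps_of_int[symmetric])
  have "fps_nth (qswap wpm) n = - fls_deriv (fps_nth (qswap zeta_fls) n) - fls_const (6 * fps_nth (G 2) n)"
    by (rule fls_eqI) (simp add: qswap_nth wpm_zeta d[symmetric] numeral_fps_const flip: d)
  also have "\<dots> = fps_nth (fps_const (cothz ^ 2 / 4) + lambert_series (\<lambda>d. of_nat d * (chz d - 6))) n"
  proof (cases "n = 0")
    case True
    have "2 * fls_deriv (cothz / 2) = fls_deriv (2 * (cothz / 2))"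
      by (simp only: fls_deriv_mult fls_deriv_numeral) simp
    then have "2 * fls_deriv (cothz / 2) = - (cothz ^ 2 - 1) / 2" by (simp add: cothz_deriv)
    moreover have "4 * fls_const (1/4) = (1 :: complex fls)" by (simp add: fls_eq_iff)
    ultimately have "- fls_deriv (cothz / 2) + fls_const (1/4) = cothz ^ 2 / 4" by (simp add: field_simps)
    then show ?thesis using True
      by (simp add: qswap_zeta lambert_series_def G2_eq)
  next
    case False
    have "fls_deriv (shz d) = of_nat d * chz d" for d
      by (simp add: shz_def chz_def ez_deriv algebra_simps fls_of_nat)
    moreover have "fls_const (6 * (\<Sum>d | d dvd n. of_nat d)) = (\<Sum>d | d dvd n. of_nat d * 6 :: complex fls)"
      by (rule fls_eqI) (simp add: fls_sum_nth fls_of_nat sum_distrib_left mult.commute[of _ 6])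
    ultimately show ?thesis using False
      by (simp add: qswap_zeta lambert_series_def G2_eq fls_deriv_sum sum_subtractf right_diff_distrib
         fls_of_nat sum_distrib_right)
  qed
  finally show "fps_nth (qswap wpm) n = fps_nth (fps_const (cothz ^ 2 / 4) + lambert_series (\<lambda>d. of_nat d * (chz d - 6))) n" .
qed

lemma sum_codivisor:
  fixes f :: "nat \<Rightarrow> 'a::comm_monoid_add"
  assumes "n > 0"
  shows "(\<Sum>d | d dvd n. f (n div d)) = (\<Sum>d | d dvd n. f d)"
  using assms by (intro sum.reindex_bij_witness[of _ "\<lambda>d. n div d" "\<lambda>d. n div d"]) auto

text \<open>Ramanujan's identity for the square of his cotangent Lambert series.\<close>
lemma zeta_fls_square: "zeta_fls ^ 2 = wpm - 4 * DG_fls"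
proof -
  \<comment> \<open>D contributes n = (n/d) d, the d completes d^(k-1) to d^k, and summing over even
    k >= 2 gives cosh(d z) - 1; hence the 2 subtracted from \<open>chz d\<close>.\<close>
  have DG: "fps_nth (qswap DG_fls) n = (\<Sum>d | d dvd n. of_nat (n div d) * (chz d - 2)) / 2" if "n > 0" for n
  proof (rule fls_eqI)
    fix m
    have two: "x / 2 = fls_const (1/2) * x" for x :: "complex fls"
    proof -
      have "2 * fls_const (1/2) = (1 :: complex fls)" by (simp add: fls_eq_iff)
      then show ?thesis by (simp add: field_simps)
    qed
    show "fls_nth (fps_nth (qswap DG_fls) n) m = fls_nth ((\<Sum>d | d dvd n. of_nat (n div d) * (chz d - 2)) / 2) m"
    proof (cases "m < 0")
      case True
      then show ?thesis by (simp add: qswap_nth DG_fls_def two fls_sum_nth chz_def ez_nth)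
    next
      case False
      then obtain k where k: "m = int k" using nonneg_int_cases by (metis not_less)
      have *: "fls_nth (of_nat (n div d) * (chz d - 2)) m =
          (if even k \<and> k \<ge> 2 then 2 * of_nat n * of_nat d ^ (k - 1) / fact k else 0)" if "d dvd n" for d
      proof -
        have "k = 0 \<Longrightarrow> fls_nth (chz d - 2) m = 0" using k by (simp add: chz_def ez_nth)
        moreover have "odd k \<Longrightarrow> fls_nth (chz d - 2) m = 0" using k odd_pos[of k] by (auto simp: chz_def ez_nth)
        moreover have "of_nat (n div d) * fls_nth (chz d - 2) m = 2 * of_nat n * of_nat d ^ (k - 1) / fact k" if "k > 0" "even k"
        proof -
          have "of_nat n = (of_nat (n div d) * of_nat d :: complex)" using \<open>d dvd n\<close> by (simp flip: of_nat_mult)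
          moreover have "of_nat d ^ k = (of_nat d * of_nat d ^ (k - 1) :: complex)"
            using \<open>k > 0\<close> by (cases k) auto
          ultimately show ?thesis using that k by (simp add: chz_def ez_nth)
        qed
        moreover have "even k \<and> k \<ge> 2 \<longleftrightarrow> even k \<and> k > 0" by (auto elim!: evenE)
        ultimately show ?thesis by auto
      qed
      have "fls_nth ((\<Sum>d | d dvd n. of_nat (n div d) * (chz d - 2)) / 2) m =
         (\<Sum>d | d dvd n. fls_nth (of_nat (n div d) * (chz d - 2)) m) / 2"
        by (simp add: two fls_sum_nth)
      also have "\<dots> = (\<Sum>d | d dvd n. (if even k \<and> k \<ge> 2 then 2 * of_nat n * of_nat d ^ (k - 1) / fact k else 0)) / 2"
        using * by (intro arg_cong2[where f="(/)"] sum.cong) auto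
      also have "\<dots> = fls_nth (fps_nth (qswap DG_fls) n) m"
        using \<open>n > 0\<close> k by (auto simp: qswap_nth DG_fls_def G_nth_pos sum_distrib_left sum_divide_distrib intro!: sum.cong)
      finally show ?thesis by simp
    qed
  qed
  have DG0: "fps_nth (qswap DG_fls) 0 = 0"
    by (rule fls_eqI) (simp add: qswap_nth DG_fls_def)
  have four: "qswap 4 = 4"
    by (intro fps_ext fls_eqI) (simp add: qswap_nth numeral_fps_const flip: fls_const_numeral)
  have "qswap (zeta_fls ^ 2) = qswap (wpm - 4 * DG_fls)"
  proof (rule fps_ext)
    fix n
    let ?l = "\<lambda>d. fps_nth (lamb d) n :: complex fls"
    show "fps_nth (qswap (zeta_fls ^ 2)) n = fps_nth (qswap (wpm - 4 * DG_fls)) n"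
    proof (cases "n = 0")
      case True
      then show ?thesis
        by (simp add: qswap_power qswap_zeta qswap_diff qswap_wpm qswap_mult four DG0 lambert_series_def
            power2_eq_square numeral_fps_const)
    next
      case False
      have sq: "fps_nth (lamb a * lamb a) n = (of_nat (n div a) - 1) * ?l a" if "a > 0" for a
        using lamb_square_nth[OF that, of n, where 'a="complex fls"] False by (simp add: lamb_nth)
      have div: "(\<Sum>d=1..n. f d * ?l d) = (\<Sum>d | d dvd n. f d)" for f :: "nat \<Rightarrow> complex fls"
        using lambert_series_nth[of n n f] False by (simp add: lambert_series_def)
      have "fps_nth (qswap (zeta_fls ^ 2)) n = fps_nth (lambert_series shz * lambert_series shz) n
          - cothz * fps_nth (lambert_series shz) n"
      proof -
        have "(fps_const (cothz / 2) - L) ^ 2 = fps_const (cothz ^ 2 / 4) + L * L - fps_const cothz * L" for L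
        proof -
          have "fps_const cothz = 2 * fps_const (cothz / 2)" "fps_const (cothz ^ 2 / 4) = fps_const (cothz / 2) ^ 2"
            by (simp_all add: numeral_fps_const power_divide fps_const_power)
          then show ?thesis by (simp add: power2_eq_square algebra_simps)
        qed
        then show ?thesis using False by (simp add: qswap_power qswap_zeta)
      qed
      also have "cothz * fps_nth (lambert_series shz) n = (\<Sum>d=1..n. (cothz * shz d) * ?l d)"
        by (simp add: lambert_series_nth[of n n] sum_distrib_left mult.assoc)
      also have "\<dots> = (\<Sum>d=1..n. (chz d + chz 0 + 2 * (\<Sum>l=1..<d. chz l)) * ?l d)"
        by (intro sum.cong) (auto simp: cothz_shz)
      also have "fps_nth (lambert_series shz * lambert_series shz) n =
          (\<Sum>d=1..n. (of_nat (d - 1) * chz d + 2 * (\<Sum>l=1..<d. chz l)) * ?l d)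
          - (\<Sum>d=1..n. (2 * chz d + chz 0) * fps_nth (lamb d * lamb d) n)"
        unfolding lambert_series_mult_nth[OF order_refl] shz_mult by (rule lamb_liouville) simp
      also have "(\<Sum>d=1..n. (2 * chz d + chz 0) * fps_nth (lamb d * lamb d) n) =
         (\<Sum>d=1..n. (2 * chz d + chz 0) * (of_nat (n div d) - 1) * ?l d)"
        by (intro sum.cong) (auto simp: sq)
      \<comment> \<open>The sums of \<open>chz l\<close> from Liouville's identity and from the
        product of coth and sinh cancel here.\<close>
      also have "(\<Sum>d=1..n. (of_nat (d - 1) * chz d + 2 * (\<Sum>l=1..<d. chz l)) * ?l d) - \<dots> -
          (\<Sum>d=1..n. (chz d + chz 0 + 2 * (\<Sum>l=1..<d. chz l)) * ?l d) =
          (\<Sum>d=1..n. (of_nat d * chz d - (2 * chz d + chz 0) * of_nat (n div d)) * ?l d)"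
        unfolding sum_subtractf[symmetric]
        by (intro sum.cong refl) (auto simp: of_nat_diff algebra_simps)
      also have "\<dots> = (\<Sum>d | d dvd n. of_nat d * chz d - (2 * chz d + 2) * of_nat (n div d))"
        unfolding div by (simp add: chz_def ez_0)
      \<comment> \<open>The summand differs from the one wanted by 6 (d - n/d), which sums to zero
        over the divisors d of n.\<close>
      also have "\<dots> = (\<Sum>d | d dvd n. of_nat d * (chz d - 6) - 2 * (of_nat (n div d) * (chz d - 2))) 
           + 6 * ((\<Sum>d | d dvd n. of_nat d) - (\<Sum>d | d dvd n. of_nat (n div d)))"
        unfolding sum_subtractf[symmetric] sum_distrib_left sum.distrib[symmetric]
        by (intro sum.cong refl) (simp add: algebra_simps)
      also have "(\<Sum>d | d dvd n. of_nat (n div d)) = (\<Sum>d | d dvd n. of_nat d :: complex fls)"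
        using False by (intro sum_codivisor) auto
      also have "(\<Sum>d | d dvd n. of_nat d * (chz d - 6) - 2 * (of_nat (n div d) * (chz d - 2))) + 6 * (\<dots> - \<dots>) =
          fps_nth (qswap (wpm - 4 * DG_fls)) n"
        using False by (simp add: qswap_diff qswap_wpm qswap_mult four DG lambert_series_def sum_subtractf
            numeral_fps_const flip: sum_distrib_left)
      finally show ?thesis .
    qed
  qed
  then show ?thesis by (simp add: qswap_eq_iff)
qed

abbreviation qderiv :: "complex fps \<Rightarrow> complex fps" where
  "qderiv f \<equiv> fps_X * fps_deriv f"

text \<open>Comparison of the coefficients of z^k in Ramanujan's identity, times k!/4. The factor of
  G_(k+2) is 1/2, from wp, plus 1/(k + 1), from the product of 1/z with the regular part of
  \<open>zeta_fls\<close>.\<close>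

lemma qderiv_G:
  assumes "k \<ge> 2"
  shows "qderiv (G k) = fps_const (of_nat (k + 3) / of_nat (2 * (k + 1))) * G (k + 2) -
    (\<Sum>i\<le>k. of_nat (k choose i) * (G (i + 1) * G (k - i + 1)))"
proof -
  define H where "H = Abs_fps (\<lambda>m. fps_const (2 / fact m) * G (m + 1))"
  have "zeta_fls ^ 2 = fls_X_inv ^ 2 - 2 * (fls_X_inv * fps_to_fls H) + fps_to_fls (H * H)"
    by (simp add: zeta_fls_def H_def power2_eq_square algebra_simps fls_times_fps_to_fls)
  then have "fls_nth (zeta_fls ^ 2) (int k) = - 2 * fps_nth H (k + 1) + fps_nth (H * H) k"
    using assms by (simp add: fls_X_inv_times_conv_shift fls_X_inv_power_conv_shift_1 nat_add_distrib)
  moreover have "fls_nth (wpm - 4 * DG_fls) (int k) = fps_const (2 / fact k) * G (k + 2) - 4 * fps_const (1 / fact k) * qderiv (G k)"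
    using assms by (simp add: wpm_def wp_def DG_fls_def)
  ultimately have "fps_const (2 / fact k) * G (k + 2) - 4 * fps_const (1 / fact k) * qderiv (G k) =
      - 2 * fps_nth H (k + 1) + fps_nth (H * H) k"
    using zeta_fls_square by simp
  then have "4 * fps_const (1 / fact k) * qderiv (G k) =
      fps_const (2 / fact k) * G (k + 2) + 2 * fps_nth H (k + 1) - fps_nth (H * H) k"
    by (simp add: algebra_simps)
  then have "fps_const (fact k / 4) * (4 * fps_const (1 / fact k) * qderiv (G k)) =
     fps_const (fact k / 4) * (fps_const (2 / fact k) * G (k + 2) + 2 * fps_nth H (k + 1) - fps_nth (H * H) k)"
    by simp
  also have "fps_const (fact k / 4) * (4 * fps_const (1 / fact k) * qderiv (G k)) = qderiv (G k)"
    by (simp add: numeral_fps_const flip: mult.assoc)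
  also have "fps_const (fact k / 4) * (fps_const (2 / fact k) * G (k + 2) + 2 * fps_nth H (k + 1) - fps_nth (H * H) k)
     = (fps_const (fact k / 4) * fps_const (2 / fact k) + fps_const (fact k / 4) * 2 * fps_const (2 / fact (k + 1))) * G (k + 2)
       - fps_const (fact k / 4) * fps_nth (H * H) k"
    by (simp add: H_def algebra_simps)
  also have "fps_const (fact k / 4) * fps_const (2 / fact k) + fps_const (fact k / 4) * 2 * fps_const (2 / fact (k + 1))
     = fps_const (of_nat (k + 3) / of_nat (2 * (k + 1)) :: complex)"
  proof -
    have "of_nat k + 1 \<noteq> (0::complex)" by (metis of_nat_Suc of_nat_eq_0_iff nat.distinct(1) add.commute)
    then have "fact k / 4 * (2 / fact k) + fact k / 4 * 2 * (2 / fact (k + 1)) = (of_nat (k + 3) / of_nat (2 * (k + 1)) :: complex)"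
      by (simp add: divide_simps) (simp add: algebra_simps)
    then show ?thesis by (simp add: numeral_fps_const)
  qed
  also have "fps_const (fact k / 4) * fps_nth (H * H) k = (\<Sum>i\<le>k. of_nat (k choose i) * (G (i + 1) * G (k - i + 1)))"
    unfolding fps_mult_nth sum_distrib_left atMost_atLeast0
  proof (intro sum.cong refl)
    fix i assume "i \<in> {0..k}"
    then have "fact k / 4 * (2 / fact i) * (2 / fact (k - i)) = (of_nat (k choose i) :: complex)"
      by (simp add: binomial_fact)
    then have "fps_const (fact k / 4) * fps_const (2 / fact i) * fps_const (2 / fact (k - i)) = (of_nat (k choose i) :: complex fps)"
      by (simp add: fps_of_nat[symmetric])
    then show "fps_const (fact k / 4) * (fps_nth H i * fps_nth H (k - i)) = of_nat (k choose i) * (G (i + 1) * G (k - i + 1))"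
      by (simp add: H_def mult.assoc mult.left_commute flip: fps_const_mult)
  qed
  finally show ?thesis .
qed

section \<open>Modular and quasi-modular forms\<close>

text \<open>The weight w part of C[G4, G6] as a set of q-series rather than of coefficient
  functions: closure properties follow by rule induction, and no uniqueness of the representation is
  involved.\<close>

inductive modular_form :: "nat \<Rightarrow> complex fps \<Rightarrow> bool" where
  zero: "modular_form w 0"
| mono: "w = 4 * b + 6 * d \<Longrightarrow> modular_form w (fps_const c * G 4 ^ b * G 6 ^ d)"
| add: "modular_form w f \<Longrightarrow> modular_form w g \<Longrightarrow> modular_form w (f + g)"

lemma modular_form_scale: "modular_form w f \<Longrightarrow> modular_form w (fps_const c * f)"
proof (induction rule: modular_form.induct)
  case (mono w b d x)
  then show ?case using modular_form.mono[of w b d "c * x"] by (simp add: mult.assoc flip: fps_const_mult)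
qed (auto simp: distrib_left intro: modular_form.intros)

lemma modular_form_diff:
  assumes "modular_form w f" "modular_form w g" shows "modular_form w (f - g)"
  using modular_form.add[OF assms(1) modular_form_scale[OF assms(2), of "-1"]] by (simp flip: fps_const_neg)

lemma modular_form_of_nat: "modular_form w f \<Longrightarrow> modular_form w (of_nat n * f)"
  using modular_form_scale[of w f "of_nat n"] by (simp add: fps_of_nat)

lemma modular_form_sum: "(\<And>i. i \<in> I \<Longrightarrow> modular_form w (f i)) \<Longrightarrow> modular_form w (sum f I)"
  by (induction I rule: infinite_finite_induct) (auto intro: modular_form.intros)

lemma modular_form_mult:
  assumes "modular_form v f" "modular_form w g" shows "modular_form (v + w) (f * g)"
  using assms(1)
proof (induction rule: modular_form.induct)
  case (mono v b d c)
  show ?case using assms(2)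
  proof (induction rule: modular_form.induct)
    case (mono w b' d' c')
    have "modular_form (v + w) (fps_const (c * c') * G 4 ^ (b + b') * G 6 ^ (d + d'))"
      using mono \<open>v = _\<close> by (intro modular_form.mono) auto
    then show ?case by (simp add: power_add algebra_simps flip: fps_const_mult)
  qed (auto simp: distrib_left intro: modular_form.intros)
qed (auto simp: distrib_right intro: modular_form.intros)

lemma modular_form_const: "modular_form 0 (fps_const c)"
  using modular_form.mono[of 0 0 0 c] by simp

lemma modular_form_G4: "modular_form 4 (G 4)" using modular_form.mono[of 4 1 0 1] by simp
lemma modular_form_G6: "modular_form 6 (G 6)" using modular_form.mono[of 6 0 1 1] by simp

lemma qderiv_G2: "qderiv (G 2) = fps_const (5/6) * G 4 - 2 * G 2 ^ 2"
proof -
  have "{..2} = {0, 1, 2 :: nat}" by auto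
  moreover have "G (Suc (Suc 0)) = G 2" by (simp only: numeral_2_eq_2)
  ultimately show ?thesis using qderiv_G[of 2] G_odd[of 1] G_odd[of 3] by (simp add: power2_eq_square)
qed

lemma qderiv_G4: "qderiv (G 4) = fps_const (7/10) * G 6 - 8 * G 2 * G 4"
proof -
  have "{..4} = {0, 1, 2, 3, 4 :: nat}" by auto
  moreover have "G (Suc (Suc 0)) = G 2" by (simp only: numeral_2_eq_2)
  moreover have "4 choose 3 = (4::nat)" by (simp add: eval_nat_numeral)
  ultimately show ?thesis using qderiv_G[of 4] G_odd[of 1] G_odd[of 3] G_odd[of 5]
    by simp
qed

lemma qderiv_G6: "qderiv (G 6) = fps_const (400/7) * G 4 ^ 2 - 12 * G 2 * G 6"
proof -
  have "{..6} = {0, 1, 2, 3, 4, 5, 6 :: nat}" by auto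
  moreover have "G (Suc (Suc 0)) = G 2" by (simp only: numeral_2_eq_2)
  moreover have "6 choose 3 = (20::nat)" "6 choose 5 = (6::nat)" by (simp_all add: eval_nat_numeral)
  ultimately have q: "qderiv (G 6) = fps_const (9/14) * 120 * G 4 ^ 2 - 20 * G 4 ^ 2 - 12 * G 2 * G 6"
    using qderiv_G[of 6] G_odd[of 1] G_odd[of 3] G_odd[of 5] G_odd[of 7]
    by (simp add: G8_eq power2_eq_square algebra_simps)
  \<comment> \<open>The factor 9/14 of G8 = 120 G4^2 meets the term i = 3, which is -20 G4^2:
    1080/14 - 20 = 400/7.\<close>
  have c: "fps_const (9/14) * 120 = fps_const (400/7) + (20 :: complex fps)"
    by (simp add: numeral_fps_const)
  show ?thesis unfolding q c by (simp add: algebra_simps)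
qed

text \<open>The Serre derivative D - (w/12) E2, rewritten with E2 = -24 G2.\<close>

definition serre :: "nat \<Rightarrow> complex fps \<Rightarrow> complex fps" where
  "serre w f = qderiv f + of_nat (2 * w) * G 2 * f"

lemma serre_mult: "serre (v + w) (f * g) = serre v f * g + f * serre w g"
  by (simp add: serre_def algebra_simps)

text \<open>The Serre derivative obeys the product rule with added weights, and on G4 and G6 its G2
  terms cancel by Ramanujan's equations; so the generators decide.\<close>

lemma modular_form_serre: "modular_form w f \<Longrightarrow> modular_form (w + 2) (serre w f)"
proof (induction rule: modular_form.induct)
  case (zero w)
  show ?case by (simp add: serre_def modular_form.zero)
next
  case (add w f g)
  have "serre w (f + g) = serre w f + serre w g" by (simp add: serre_def algebra_simps)
  then show ?case using add modular_form.add by simp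
next
  case (mono w b d c)
  have pow: "modular_form (k * n + 2) (serre (k * n) (f ^ n))"
    if "modular_form k f" "modular_form (k + 2) (serre k f)" for k n f
  proof (induction n)
    case 0
    show ?case by (simp add: serre_def modular_form.zero)
  next
    case (Suc n)
    have m: "modular_form (k * n) (f ^ n)" 
      by (induction n) (use modular_form_const[of 1] modular_form_mult[OF that(1)] in auto)
    have "serre (k * Suc n) (f ^ Suc n) = serre k f * f ^ n + f * serre (k * n) (f ^ n)"
      using serre_mult[of k "k * n" f "f ^ n"] by simp
    moreover have "modular_form (k * Suc n + 2) (serre k f * f ^ n)"
      using modular_form_mult[OF that(2) m] by (simp add: algebra_simps)
    moreover have "modular_form (k * Suc n + 2) (f * serre (k * n) (f ^ n))"
      using modular_form_mult[OF that(1) Suc] by (simp add: algebra_simps)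
    ultimately show ?case by (simp only: modular_form.add)
  qed
  have "serre 4 (G 4) = fps_const (7/10) * G 6" by (simp add: serre_def qderiv_G4)
  then have 4: "modular_form (4 * b + 2) (serre (4 * b) (G 4 ^ b))"
    using pow[of 4 "G 4" b] modular_form_G4 modular_form_scale[OF modular_form_G6] by simp
  have "serre 6 (G 6) = fps_const (400/7) * G 4 ^ 2" by (simp add: serre_def qderiv_G6)
  then have 6: "modular_form (6 * d + 2) (serre (6 * d) (G 6 ^ d))"
    using pow[of 6 "G 6" d] modular_form_G6 modular_form_scale[OF modular_form_mult[OF modular_form_G4 modular_form_G4]]
    by (simp add: power2_eq_square)
  have m4: "modular_form (4 * b) (G 4 ^ b)" and m6: "modular_form (6 * d) (G 6 ^ d)"
    using modular_form.mono[of "4 * b" b 0 1] modular_form.mono[of "6 * d" 0 d 1] by simp_all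
  have "modular_form (w + 2) (serre (4 * b) (G 4 ^ b) * G 6 ^ d + G 4 ^ b * serre (6 * d) (G 6 ^ d))"
    using modular_form_mult[OF 4 m6] modular_form_mult[OF m4 6] mono
    by (intro modular_form.add) (simp_all add: algebra_simps)
  also have "serre (4 * b) (G 4 ^ b) * G 6 ^ d + G 4 ^ b * serre (6 * d) (G 6 ^ d) = serre w (G 4 ^ b * G 6 ^ d)"
    by (simp add: serre_mult mono)
  finally have "modular_form (w + 2) (fps_const c * serre w (G 4 ^ b * G 6 ^ d))"
    by (rule modular_form_scale)
  also have "fps_const c * serre w (G 4 ^ b * G 6 ^ d) = serre w (fps_const c * G 4 ^ b * G 6 ^ d)"
    by (simp add: serre_def algebra_simps)
  finally show ?case .
qed

text \<open>For k = j + 2 >= 8 the identity for D(G_j) is solved for G_k. Only the terms i = 1 and i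
  = j - 1 contain G2; together they are 2 j G2 G_j, just what completes D(G_j) to the Serre
  derivative. The ends i = 0 and i = j contain G_1 = 0.\<close>

lemma modular_form_G:
  assumes "k \<noteq> 2"
  shows "modular_form k (G k)"
  using assms
proof (induction k rule: less_induct)
  case (less k)
  consider "odd k \<or> k < 2" | "k = 4" | "k = 6" | j where "k = j + 2" "j \<ge> 6" "even k"
  proof -
    have "odd k \<or> k < 2 \<or> k = 2 \<or> k = 4 \<or> k = 6 \<or> even k \<and> k \<ge> 8" by presburger
    then show thesis using that(1,2,3) that(4)[of "k - 2"] less.prems by fastforce
  qed
  then show ?case
  proof cases
    case 1
    then show ?thesis by (auto simp: G_def modular_form.zero)
  next
    case 4
    let ?t = "\<lambda>i. of_nat (j choose i) * (G (i + 1) * G (j - i + 1))"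
    have mid: "modular_form k (sum ?t {2..j - 2})"
    proof (intro modular_form_sum modular_form_of_nat)
      fix i assume i: "i \<in> {2..j - 2}"
      have "modular_form (i + 1 + (j - i + 1)) (G (i + 1) * G (j - i + 1))"
        using i 4 by (intro modular_form_mult less.IH) auto
      moreover have "i + 1 + (j - i + 1) = k" using i 4 by auto
      ultimately show "modular_form k (G (i + 1) * G (j - i + 1))" by metis
    qed
    have "{..j} = {0, 1, j - 1, j} \<union> {2..j - 2}" using 4 by auto
    then have "sum ?t {..j} = sum ?t ({0, 1, j - 1, j} \<union> {2..j - 2})" by simp
    also have "\<dots> = sum ?t {0, 1, j - 1, j} + sum ?t {2..j - 2}"
      using 4 by (intro sum.union_disjoint) auto
    also have "sum ?t {0, 1, j - 1, j} = of_nat (2 * j) * G 2 * G j"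
    proof -
      have "j choose (j - Suc 0) = j" using 4 binomial_symmetric[of 1 j] by simp
      moreover have "G (Suc 0) = 0" "G (Suc (Suc 0)) = G 2" by (simp add: G_def) (simp only: numeral_2_eq_2)
      ultimately show ?thesis using 4 by simp
    qed
    finally have "fps_const (of_nat (j + 3) / of_nat (2 * (j + 1))) * G k = serre j (G j) + sum ?t {2..j - 2}"
      using qderiv_G[of j] 4 by (simp add: serre_def algebra_simps)
    also have "modular_form k \<dots>"
      using modular_form_serre[OF less.IH[of j]] mid 4 by (auto intro: modular_form.add)
    finally have "modular_form k (fps_const (of_nat (2 * (j + 1)) / of_nat (j + 3)) * (fps_const (of_nat (j + 3) / of_nat (2 * (j + 1))) * G k))"
      by (rule modular_form_scale)
    moreover have "of_nat (2 * (j + 1)) / of_nat (j + 3) * (of_nat (j + 3) / of_nat (2 * (j + 1))) = (1 :: complex)"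
      by (simp del: of_nat_add of_nat_mult of_nat_Suc)
    ultimately show ?thesis by (simp only: mult.assoc[symmetric] fps_const_mult) simp
  qed (use modular_form_G4 modular_form_G6 in auto)
qed

text \<open>Pairs of the values of a weight-homogeneous polynomial in G2, G4, G6 and of its partial
  derivative with respect to G2.\<close>
inductive quasimodular :: "nat \<Rightarrow> complex fps \<Rightarrow> complex fps \<Rightarrow> bool" where
  zero: "quasimodular w 0 0"
| mono: "w = 2 * a + 4 * b + 6 * d \<Longrightarrow> quasimodular w
    (fps_const c * G 2 ^ a * G 4 ^ b * G 6 ^ d)
    (fps_const (of_nat a * c) * G 2 ^ (a - 1) * G 4 ^ b * G 6 ^ d)"
| add: "quasimodular w f f' \<Longrightarrow> quasimodular w g g' \<Longrightarrow> quasimodular w (f + g) (f' + g')"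

lemma quasimodular_scale: "quasimodular w f f' \<Longrightarrow> quasimodular w (fps_const c * f) (fps_const c * f')"
proof (induction rule: quasimodular.induct)
  case (mono w a b d x)
  from quasimodular.mono[OF this, of "c * x"] show ?case by (simp add: algebra_simps flip: fps_const_mult)
qed (auto simp: distrib_left intro: quasimodular.intros)

lemma quasimodular_diff:
  assumes "quasimodular w f f'" "quasimodular w g g'" shows "quasimodular w (f - g) (f' - g')"
  using quasimodular.add[OF assms(1) quasimodular_scale[OF assms(2), of "-1"]] by (simp flip: fps_const_neg)

lemma quasimodular_sum:
  "(\<And>i. i \<in> I \<Longrightarrow> quasimodular w (f i) (f' i)) \<Longrightarrow> quasimodular w (sum f I) (sum f' I)"
  by (induction I rule: infinite_finite_induct) (auto intro: quasimodular.intros)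

lemma quasimodular_mult:
  assumes "quasimodular v f f'" "quasimodular w g g'"
  shows "quasimodular (v + w) (f * g) (f' * g + f * g')"
  using assms(1)
proof (induction rule: quasimodular.induct)
  case (mono v a b d c)
  show ?case using assms(2)
  proof (induction rule: quasimodular.induct)
    case (mono w a' b' d' c')
    \<comment> \<open>For a = 0 the truncated exponent a - 1 does no harm, because its term carries
      the factor a.\<close>
    have a: "fps_const (of_nat a) * G 2 ^ (a - 1) * G 2 ^ a' + fps_const (of_nat a') * G 2 ^ a * G 2 ^ (a' - 1) 
      = fps_const (of_nat (a + a')) * G 2 ^ (a + a' - 1)"
      by (cases a; cases a') (simp_all add: algebra_simps power_add flip: fps_const_add)
    have "quasimodular (v + w) (fps_const (c * c') * G 2 ^ (a + a') * G 4 ^ (b + b') * G 6 ^ (d + d'))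
       (fps_const (of_nat (a + a') * (c * c')) * G 2 ^ (a + a' - 1) * G 4 ^ (b + b') * G 6 ^ (d + d'))"
      using mono \<open>v = _\<close> by (intro quasimodular.mono) auto
    also have "fps_const (of_nat (a + a') * (c * c')) * G 2 ^ (a + a' - 1) * G 4 ^ (b + b') * G 6 ^ (d + d') =
       fps_const (c * c') * G 4 ^ (b + b') * G 6 ^ (d + d') * (fps_const (of_nat (a + a')) * G 2 ^ (a + a' - 1))"
      by (simp only: fps_const_mult[symmetric] mult_ac)
    also have "\<dots> = fps_const (of_nat a * c) * G 2 ^ (a - 1) * G 4 ^ b * G 6 ^ d * (fps_const c' * G 2 ^ a' * G 4 ^ b' * G 6 ^ d')
        + fps_const c * G 2 ^ a * G 4 ^ b * G 6 ^ d * (fps_const (of_nat a' * c') * G 2 ^ (a' - 1) * G 4 ^ b' * G 6 ^ d')"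
      unfolding a[symmetric] by (simp only: fps_const_mult[symmetric] power_add ring_distribs mult_ac)
    also have "fps_const (c * c') * G 2 ^ (a + a') * G 4 ^ (b + b') * G 6 ^ (d + d') =
        fps_const c * G 2 ^ a * G 4 ^ b * G 6 ^ d * (fps_const c' * G 2 ^ a' * G 4 ^ b' * G 6 ^ d')"
      by (simp only: fps_const_mult[symmetric] power_add mult_ac)
    finally show ?case .
  next
    case (add w g g' h h')
    from quasimodular.add[OF add.IH] show ?case by (simp add: algebra_simps)
  qed (simp add: quasimodular.zero)
next
  case (add v f f' h h')
  from quasimodular.add[OF add.IH] show ?case by (simp add: algebra_simps)
qed (simp add: quasimodular.zero)

lemma modular_form_imp_quasimodular: "modular_form w f \<Longrightarrow> quasimodular w f 0"
proof (induction rule: modular_form.induct)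
  case (mono w b d c)
  then show ?case using quasimodular.mono[of w 0 b d c] by simp
next
  case (add w f g)
  then show ?case using quasimodular.add by fastforce
qed (rule quasimodular.zero)

text \<open>A fixed weight bounds all exponents. Finiteness matters for \<open>qm_eval\<close>,
  since a sum over an infinite set is 0 by convention.\<close>

lemma qm_homog_finite: assumes "qm_homog w c" shows "finite {x. c x \<noteq> 0}"
proof (rule finite_subset)
  have "2 * a + 4 * b + 6 * d = w" if "c (a, b, d) \<noteq> 0" for a b d
    using assms that by (auto simp: qm_homog_def)
  then show "{x. c x \<noteq> 0} \<subseteq> {..w} \<times> {..w} \<times> {..w}" by fastforce
qed auto

definition monom_val :: "nat \<times> nat \<times> nat \<Rightarrow> complex fps" where
  "monom_val = (\<lambda>(a, b, d). G 2 ^ a * G 4 ^ b * G 6 ^ d)"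

lemma qm_eval_eq:
  assumes "finite S" "{x. c x \<noteq> 0} \<subseteq> S"
  shows "qm_eval c = (\<Sum>x\<in>S. fps_const (c x) * monom_val x)"
  unfolding qm_eval_def
  by (rule sum.mono_neutral_cong_left) (use assms in \<open>auto simp: monom_val_def mult.assoc\<close>)

lemma qm_eval_lincomb:
  assumes "qm_homog w c" "qm_homog w c'"
  shows "qm_eval (\<lambda>x. c x + u * c' x) = qm_eval c + fps_const u * qm_eval c'"
proof -
  define S where "S = {x. c x \<noteq> 0} \<union> {x. c' x \<noteq> 0}"
  have fin: "finite S" using assms qm_homog_finite by (auto simp: S_def)
  have "qm_eval c = (\<Sum>x\<in>S. fps_const (c x) * monom_val x)"
    by (rule qm_eval_eq[OF fin]) (auto simp: S_def)
  moreover have "qm_eval c' = (\<Sum>x\<in>S. fps_const (c' x) * monom_val x)"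
    by (rule qm_eval_eq[OF fin]) (auto simp: S_def)
  moreover have "qm_eval (\<lambda>x. c x + u * c' x) = (\<Sum>x\<in>S. fps_const (c x + u * c' x) * monom_val x)"
    by (rule qm_eval_eq[OF fin]) (auto simp: S_def)
  ultimately show ?thesis
    by (simp add: sum.distrib sum_distrib_left algebra_simps flip: fps_const_add fps_const_mult)
qed

lemma qm_homog_lincomb: "qm_homog w c \<Longrightarrow> qm_homog w c' \<Longrightarrow> qm_homog w (\<lambda>x. c x + u * c' x)"
  by (simp add: qm_homog_def)

lemma qm_dG2_lincomb: "qm_dG2 (\<lambda>x. c x + u * c' x) = (\<lambda>x. qm_dG2 c x + u * qm_dG2 c' x)"
  by (auto simp: qm_dG2_def algebra_simps)

lemma qm_homog_dG2: "qm_homog (w + 2) c \<Longrightarrow> qm_homog w (qm_dG2 c)"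
  by (auto simp: qm_homog_def qm_dG2_def)

lemma qm_homog_dG2_low: "qm_homog w c \<Longrightarrow> w < 2 \<Longrightarrow> qm_dG2 c = (\<lambda>_. 0)"
  by (auto simp: qm_homog_def qm_dG2_def)

text \<open>In weight below 2 there is no G2 and the derivative is zero, so the truncated w - 2 is
  correct there as well.\<close>

lemma qm_homog_dG2': "qm_homog w c \<Longrightarrow> qm_homog (w - 2) (qm_dG2 c)"
  by (cases "w < 2") (use qm_homog_dG2_low qm_homog_dG2[of "w - 2"] in \<open>auto simp: qm_homog_def\<close>)

lemma quasimodular_imp_qm:
  "quasimodular w f f' \<Longrightarrow> \<exists>c. qm_homog w c \<and> f = qm_eval c \<and> f' = qm_eval (qm_dG2 c)"
proof (induction rule: quasimodular.induct)
  case (zero w)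
  show ?case by (rule exI[of _ "\<lambda>_. 0"]) (auto simp: qm_homog_def qm_eval_def qm_dG2_def)
next
  case (mono w a b d c)
  define k where "k = (\<lambda>x. if x = (a, b, d) then c else 0)"
  have "qm_homog w k" using mono by (auto simp: k_def qm_homog_def)
  moreover have "qm_eval k = fps_const c * G 2 ^ a * G 4 ^ b * G 6 ^ d"
    by (subst qm_eval_eq[of "{(a, b, d)}"]) (auto simp: k_def monom_val_def mult.assoc)
  moreover have "qm_eval (qm_dG2 k) = fps_const (of_nat a * c) * G 2 ^ (a - 1) * G 4 ^ b * G 6 ^ d"
  proof -
    have "qm_dG2 k = (\<lambda>x. if x = (a - 1, b, d) then of_nat a * c else 0)"
      by (cases a) (auto simp: k_def qm_dG2_def fun_eq_iff)
    then show ?thesis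
      by (subst qm_eval_eq[of "{(a - 1, b, d)}"]) (auto simp: monom_val_def mult.assoc)
  qed
  ultimately show ?case by metis
next
  case (add w f f' g g')
  then obtain c c' where c: "qm_homog w c" "f = qm_eval c" "f' = qm_eval (qm_dG2 c)"
    and c': "qm_homog w c'" "g = qm_eval c'" "g' = qm_eval (qm_dG2 c')" by blast
  have "qm_eval (\<lambda>x. c x + 1 * c' x) = f + g"
    by (subst qm_eval_lincomb[OF c(1) c'(1)]) (simp add: c c')
  moreover have "qm_eval (qm_dG2 (\<lambda>x. c x + 1 * c' x)) = f' + g'"
    unfolding qm_dG2_lincomb
    by (subst qm_eval_lincomb[OF qm_homog_dG2'[OF c(1)] qm_homog_dG2'[OF c'(1)]]) (simp add: c c')
  ultimately show ?case using qm_homog_lincomb[OF c(1) c'(1)] by metis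
qed

section \<open>Formal square roots and condition (a)\<close>

function sqrt_coeff :: "'a::comm_ring_1 \<Rightarrow> (nat \<Rightarrow> 'a) \<Rightarrow> nat \<Rightarrow> 'a" where
  "sqrt_coeff h w n = (if n = 0 then 1
     else h * (w n - (\<Sum>i=1..<n. sqrt_coeff h w i * sqrt_coeff h w (n - i))))"
  by auto
termination by (relation "Wellfounded.measure (\<lambda>(h, w, n). n)") auto

declare sqrt_coeff.simps [simp del]

text \<open>The first argument plays the role of 1/2.\<close>
definition fps_sqrt :: "'a::comm_ring_1 \<Rightarrow> 'a fps \<Rightarrow> 'a fps" where
  "fps_sqrt h f = Abs_fps (sqrt_coeff h (fps_nth f))"

lemma fps_sqrt_nth_0: "fps_nth (fps_sqrt h f) 0 = 1"
  by (simp add: fps_sqrt_def sqrt_coeff.simps)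

lemma fps_sqrt_nth:
  "n > 0 \<Longrightarrow> fps_nth (fps_sqrt h f) n =
     h * (fps_nth f n - (\<Sum>i=1..<n. fps_nth (fps_sqrt h f) i * fps_nth (fps_sqrt h f) (n - i)))"
  by (simp add: fps_sqrt_def sqrt_coeff.simps[of _ _ n])

lemma sum_split_ends:
  fixes f :: "nat \<Rightarrow> 'a::comm_monoid_add"
  assumes "n > 0" shows "(\<Sum>i=0..n. f i) = f 0 + f n + (\<Sum>i=1..<n. f i)"
proof -
  have "{0..n} = {0, n} \<union> {1..<n}" using assms by auto
  then have "(\<Sum>i=0..n. f i) = (\<Sum>i\<in>{0, n} \<union> {1..<n}. f i)" by simp
  also have "\<dots> = (\<Sum>i\<in>{0, n}. f i) + (\<Sum>i=1..<n. f i)"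
    by (rule sum.union_disjoint) auto
  finally show ?thesis using assms by (simp add: add.assoc)
qed

text \<open>A commutative ring with an inverse h of 2 is enough, so the construction serves over
  q-series, for wp - 4 G2, as well as over complex numbers, for E4.\<close>

lemma fps_sqrt_square:
  assumes "fps_nth f 0 = 1" "2 * h = 1"
  shows "fps_sqrt h f ^ 2 = f"
proof (rule fps_ext)
  fix n
  let ?u = "fps_nth (fps_sqrt h f)"
  show "fps_nth (fps_sqrt h f ^ 2) n = fps_nth f n"
  proof (cases "n = 0")
    case True
    then show ?thesis by (simp add: power2_eq_square fps_sqrt_nth_0 assms(1))
  next
    case False
    then have "fps_nth (fps_sqrt h f ^ 2) n = 2 * ?u n + (\<Sum>i=1..<n. ?u i * ?u (n - i))"
      unfolding power2_eq_square fps_mult_nth by (subst sum_split_ends) (simp_all add: fps_sqrt_nth_0)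
    also have "2 * ?u n = (2 * h) * (fps_nth f n - (\<Sum>i=1..<n. ?u i * ?u (n - i)))"
      using False fps_sqrt_nth[of n h f] by (simp add: mult.assoc)
    also have "2 * h = 1" by fact
    finally show ?thesis by simp
  qed
qed

text \<open>z^2 (wp - 4 G2), its square root, and the derivative of the latter with respect to G2.\<close>
definition Wz :: "complex fps fps" where
  "Wz = Abs_fps (\<lambda>j. if j = 0 then 1 else if j = 2 then - 4 * G 2
     else if j \<ge> 4 then fps_const (2 / fact (j - 2)) * G j else 0)"

definition Uz :: "complex fps fps" where "Uz = fps_sqrt (fps_const (1/2)) Wz"
definition Uz' :: "complex fps fps" where "Uz' = - 2 * fps_X ^ 2 * fps_right_inverse Uz 1"

lemma two_half: "2 * fps_const (1/2) = (1 :: complex fps)"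
  by (simp add: numeral_fps_const)

lemma Uz_square: "Uz ^ 2 = Wz"
  unfolding Uz_def by (rule fps_sqrt_square) (auto simp: two_half Wz_def)

lemma Uz_nth_0: "fps_nth Uz 0 = 1" by (simp add: Uz_def fps_sqrt_nth_0)

lemma Uz_nth_1: "fps_nth Uz 1 = 0" by (simp add: Uz_def fps_sqrt_nth Wz_def)

text \<open>Half of the G2-derivative of \<open>Uz ^ 2 = Wz\<close>, where G2 occurs only in the
  term -4 G2 z^2.\<close>

lemma Uz_Uz': "Uz * Uz' = - 2 * fps_X ^ 2"
proof -
  have "Uz * fps_right_inverse Uz 1 = 1"
    by (rule fps_right_inverse) (simp add: Uz_nth_0)
  then show ?thesis by (simp add: Uz'_def mult.left_commute)
qed

lemma Uz'_nth_0: "fps_nth Uz' 0 = 0" by (simp add: Uz'_def)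

lemma quasimodular_Wz: "quasimodular j (fps_nth Wz j) (if j = 2 then - 4 else 0)"
proof -
  have 0: "quasimodular 0 1 0" using quasimodular.mono[of 0 0 0 0 1] by simp
  have 2: "quasimodular 2 (- 4 * G 2) (- 4)"
    using quasimodular.mono[of 2 1 0 0 "-4"] by (simp add: numeral_fps_const)
  have "quasimodular j (fps_const (2 / fact (j - 2)) * G j) 0" if "j \<ge> 4"
    using that by (intro modular_form_imp_quasimodular modular_form_scale modular_form_G) auto
  then show ?thesis using 0 2 by (auto simp: Wz_def intro: quasimodular.zero)
qed

text \<open>The recursion that \<open>Uz_Uz'\<close> gives for \<open>Uz'\<close> is the formal
  G2-derivative of the one for the coefficients of \<open>Uz\<close>, so a single induction treats
  the pair.\<close>

lemma quasimodular_Uz: "quasimodular j (fps_nth Uz j) (fps_nth Uz' j)"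
proof (induction j rule: less_induct)
  case (less j)
  show ?case
  proof (cases "j = 0")
    case True
    then show ?thesis using quasimodular.mono[of 0 0 0 0 1] by (simp add: Uz_nth_0 Uz'_nth_0)
  next
    case False
    let ?u = "fps_nth Uz" and ?v = "fps_nth Uz'"
    have u: "?u j = fps_const (1/2) * (fps_nth Wz j - (\<Sum>i=1..<j. ?u i * ?u (j - i)))"
      using False unfolding Uz_def by (subst fps_sqrt_nth) auto
    have sym: "(\<Sum>i=1..<j. ?v i * ?u (j - i)) = (\<Sum>i=1..<j. ?u i * ?v (j - i))"
      by (rule sum.reindex_bij_witness[of _ "\<lambda>i. j - i" "\<lambda>i. j - i"]) auto
    have "fps_nth (Uz * Uz') j = (if j = 2 then -2 else 0)"
      unfolding Uz_Uz' by (simp add: numeral_fps_const flip: fps_const_neg)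
    then have "?v j + (\<Sum>i=1..<j. ?u i * ?v (j - i)) = (if j = 2 then -2 else 0)"
      using False by (simp add: fps_mult_nth sum_split_ends Uz_nth_0 Uz'_nth_0)
    then have "?v j = (if j = 2 then -2 else 0) - (\<Sum>i=1..<j. ?u i * ?v (j - i))"
      by (simp add: eq_diff_eq)
    also have "\<dots> = fps_const (1/2) * ((if j = 2 then -4 else 0) - (\<Sum>i=1..<j. ?v i * ?u (j - i) + ?u i * ?v (j - i)))"
    proof -
      have h4: "fps_const (1/2) * 4 = (2 :: complex fps)" by (simp add: numeral_fps_const)
      have hx: "fps_const (1/2) * (2 * x) = x" for x :: "complex fps"
        using two_half by (simp add: mult.left_commute[of _ 2] flip: mult.assoc)
      show ?thesis unfolding sum.distrib sym by (auto simp: right_diff_distrib h4 hx)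
    qed
    finally have v: "?v j = \<dots>" .
    have "quasimodular j (\<Sum>i=1..<j. ?u i * ?u (j - i)) (\<Sum>i=1..<j. ?v i * ?u (j - i) + ?u i * ?v (j - i))"
    proof (rule quasimodular_sum)
      fix i assume i: "i \<in> {1..<j}"
      then have "quasimodular (i + (j - i)) (?u i * ?u (j - i)) (?v i * ?u (j - i) + ?u i * ?v (j - i))"
        by (intro quasimodular_mult less.IH) auto
      then show "quasimodular j (?u i * ?u (j - i)) (?v i * ?u (j - i) + ?u i * ?v (j - i))" using i by simp
    qed
    from quasimodular_scale[OF quasimodular_diff[OF quasimodular_Wz this]]
    show ?thesis unfolding u v .
  qed
qed

lemma quasimodular_Uz_power:
  "quasimodular j (fps_nth (Uz ^ n) j) (fps_nth (of_nat n * Uz ^ (n - 1) * Uz') j)"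
proof (induction n arbitrary: j)
  case 0
  then show ?case using quasimodular.mono[of 0 0 0 0 1] by (auto intro: quasimodular.zero)
next
  case (Suc n)
  let ?d = "of_nat n * Uz ^ (n - 1) * Uz'"
  have "quasimodular j (\<Sum>i=0..j. fps_nth Uz i * fps_nth (Uz ^ n) (j - i))
      (\<Sum>i=0..j. fps_nth Uz' i * fps_nth (Uz ^ n) (j - i) + fps_nth Uz i * fps_nth ?d (j - i))"
  proof (rule quasimodular_sum)
    fix i assume i: "i \<in> {0..j}"
    then show "quasimodular j (fps_nth Uz i * fps_nth (Uz ^ n) (j - i))
        (fps_nth Uz' i * fps_nth (Uz ^ n) (j - i) + fps_nth Uz i * fps_nth ?d (j - i))"
      using quasimodular_mult[OF quasimodular_Uz[of i] Suc.IH[of "j - i"]] by simp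
  qed
  also have "(\<Sum>i=0..j. fps_nth Uz i * fps_nth (Uz ^ n) (j - i)) = fps_nth (Uz ^ Suc n) j"
    by (simp add: fps_mult_nth)
  also have "(\<Sum>i=0..j. fps_nth Uz' i * fps_nth (Uz ^ n) (j - i) + fps_nth Uz i * fps_nth ?d (j - i)) =
     fps_nth (Uz' * Uz ^ n + Uz * ?d) j"
    by (simp add: fps_mult_nth sum.distrib)
  also have "Uz' * Uz ^ n + Uz * ?d = of_nat (Suc n) * Uz ^ (Suc n - 1) * Uz'"
    by (cases n) (simp_all add: algebra_simps)
  finally show ?case .
qed

lemma wpm_Wz: "wpm = fls_shift 2 (fps_to_fls Wz)"
proof (rule fls_eqI)
  fix m :: int
  have G3: "G 3 = 0" by (simp add: G_def)
  consider "m < -2" | "m = -2" | "m = -1" | "m = 0" | "m = 1" | "m > 1" by linarith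
  then show "fls_nth wpm m = fls_nth (fls_shift 2 (fps_to_fls Wz)) m"
  proof cases
    case 6
    then obtain k where k: "m = int k" "k > 1" by (metis nonneg_int_cases less_imp_le of_nat_1 of_nat_less_iff zero_less_one order_less_trans)
    then show ?thesis by (simp add: wpm_def wp_def Wz_def nat_add_distrib)
  qed (auto simp: wpm_def wp_def Wz_def G3)
qed

lemma shift_Uz_square: "fls_shift 1 (fps_to_fls Uz) ^ 2 = wpm"
  by (simp add: wpm_Wz power2_eq_square fls_shifted_times_simps flip: Uz_square)
     (simp add: fls_times_fps_to_fls)

text \<open>Laurent series over a domain form a domain, so a second root could only be the negative
  one, whose leading coefficient is -1.\<close>

lemma sqrt_wpm_Uz: "sqrt_wpm = fls_shift 1 (fps_to_fls Uz)"
  unfolding sqrt_wpm_def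
proof (rule the_equality)
  let ?S = "fls_shift 1 (fps_to_fls Uz)"
  note sq = shift_Uz_square
  show "?S ^ 2 = wpm \<and> (\<forall>n < -1. fls_nth ?S n = 0) \<and> fls_nth ?S (-1) = 1 \<and> fls_nth ?S 0 = 0"
    using sq Uz_nth_1 by (auto simp: Uz_nth_0)
  fix S assume S: "S ^ 2 = wpm \<and> (\<forall>n < -1. fls_nth S n = 0) \<and> fls_nth S (-1) = 1 \<and> fls_nth S 0 = 0"
  then have "S ^ 2 = ?S ^ 2" using sq by simp
  then consider "S = ?S" | "S = - ?S" by (auto simp: power2_eq_iff)
  then show "S = ?S"
  proof cases
    case 2
    then have "fls_nth S (-1) = -1" by (simp add: Uz_nth_0)
    then show ?thesis using S by (simp add: one_neq_neg_one)
  qed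
qed

definition A_factor :: "nat \<Rightarrow> complex" where
  "A_factor k = (-1) ^ k / of_nat (odd_dfact k)"

text \<open>Since (wp - 4 G2)^(k + 1/2) is z^(-2k-1) times the power 2k + 1 of \<open>Uz\<close>,
  the residue is a coefficient of z^(2k), whence the weight 2k.\<close>

lemma A_Uz: "A k = fps_const (A_factor k) * fps_nth (Uz ^ (2 * k + 1)) (2 * k)"
proof -
  have "wpm ^ k * sqrt_wpm = fls_shift (2 * int k + 1) (fps_to_fls (Wz ^ k * Uz))"
    by (simp add: wpm_Wz sqrt_wpm_Uz fls_shifted_pow fls_times_both_shifted_simp fls_times_fps_to_fls fps_to_fls_power mult.commute add.commute)
  also have "Wz ^ k * Uz = Uz ^ (2 * k + 1)"
    by (simp add: power_mult Uz_square[symmetric])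
  finally show ?thesis by (simp add: A_def A_factor_def nat_mult_distrib)
qed

lemma odd_dfact_Suc: "odd_dfact (Suc k) = (2 * k + 3) * odd_dfact k"
  by (simp add: odd_dfact_def algebra_simps)

lemma odd_dfact_pos: "odd_dfact k > 0"
  by (simp add: odd_dfact_def)

lemma A_factor_Suc: "A_factor (Suc k) * of_nat (2 * k + 3) = - A_factor k"
proof -
  have "of_nat (2 * k + 3) \<noteq> (0 :: complex)" by (subst of_nat_eq_0_iff) simp
  then show ?thesis unfolding A_factor_def odd_dfact_Suc of_nat_mult by (simp del: of_nat_add of_nat_mult)
qed

text \<open>Writing U for \<open>Uz\<close>, the G2-derivative of U^(2k+1) is (2k+1) U^(2k) U' = -2
  (2k+1) z^2 U^(2k-1). The factor z^2 moves the coefficient from z^(2k) to z^(2k-2), and the signed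
  double factorial absorbs -(2k+1). For k = 0 the constant term of U' is 0.\<close>

lemma prop_a_A: "prop_a A"
  unfolding prop_a_def
proof
  fix k
  let ?d = "fps_const (A_factor k) * fps_nth (of_nat (2 * k + 1) * Uz ^ (2 * k) * Uz') (2 * k)"
  have "quasimodular (2 * k) (A k) ?d"
    using quasimodular_scale[OF quasimodular_Uz_power[of "2 * k" "2 * k + 1"], of "A_factor k"]
    by (simp add: A_Uz)
  moreover have "?d = 2 * (if k = 0 then 0 else A (k - 1))"
  proof (cases k)
    case 0
    then show ?thesis by (simp add: Uz'_nth_0)
  next
    case (Suc l)
    define N where "N = (of_nat (2 * l + 3) :: complex)"
    have N: "of_nat (2 * k + 1) = (fps_const (fps_const N) :: complex fps fps)"
      unfolding N_def fps_of_nat by (simp add: Suc)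
    have "of_nat (2 * k + 1) * Uz ^ (2 * k) * Uz' = fps_const (fps_const N) * Uz ^ (2 * l + 1) * (Uz * Uz')"
      unfolding N by (simp add: Suc mult.assoc mult.left_commute)
    also have "\<dots> = fps_const (fps_const N) * - (2 * (fps_X ^ 2 * Uz ^ (2 * l + 1)))"
      unfolding Uz_Uz' by (simp only: mult_minus_left mult_minus_right mult.assoc mult.left_commute mult.commute)
    finally have "fps_nth (of_nat (2 * k + 1) * Uz ^ (2 * k) * Uz') (2 * k) = - (2 * fps_const N * fps_nth (Uz ^ (2 * l + 1)) (2 * l))"
      by (simp add: Suc fps_X_power_mult_nth numeral_fps_const mult.assoc mult.left_commute del: power_Suc power_Suc2)
    then have "?d = - 2 * fps_const (A_factor k * N) * fps_nth (Uz ^ (2 * l + 1)) (2 * l)"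
      by (simp only: fps_const_mult[symmetric] mult_minus_left mult_minus_right mult_ac)
    also have "\<dots> = 2 * A l" unfolding Suc N_def A_factor_Suc A_Uz by (simp flip: fps_const_neg)
    finally show ?thesis using Suc by simp
  qed
  ultimately have "quasimodular (2 * k) (A k) (2 * (if k = 0 then 0 else A (k - 1)))" by simp
  from quasimodular_imp_qm[OF this] obtain c where "qm_homog (2 * k) c" "A k = qm_eval c"
    "2 * (if k = 0 then 0 else A (k - 1)) = qm_eval (qm_dG2 c)" by blast
  then show "\<exists>c. qm_homog (2 * k) c \<and> A k = qm_eval c \<and>
      qm_eval (qm_dG2 c) = 2 * (if k = 0 then 0 else A (k - 1))"
    by (intro exI[of _ c]) simp
qed

lemma prop_c_A: "prop_c A"
  by (simp add: prop_c_def A_Uz A_factor_def odd_dfact_def Uz_nth_0)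

section \<open>The coefficients of $A_k$\<close>

text \<open>Serves to evaluate polynomials over one ring at a point of another. The evaluation map
  is again such a homomorphism, so doing it twice evaluates polynomials in two variables, encoded as
  \<open>complex poly poly\<close>.\<close>

locale coeff_hom =
  fixes h :: "'a::comm_ring_1 \<Rightarrow> 'b::comm_ring_1"
  assumes h_1: "h 1 = 1" and h_add: "h (a + b) = h a + h b" and h_mult: "h (a * b) = h a * h b"
begin

lemma h_0 [simp]: "h 0 = 0" using h_add[of 0 0] by simp

definition eval_at :: "'b \<Rightarrow> 'a poly \<Rightarrow> 'b" where
  "eval_at x p = poly (map_poly h p) x"

lemma eval_at_pCons: "eval_at x (pCons c p) = h c + x * eval_at x p"
  by (simp add: eval_at_def map_poly_pCons)

lemma eval_at_0 [simp]: "eval_at x 0 = 0" by (simp add: eval_at_def)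

lemma eval_at_1 [simp]: "eval_at x 1 = 1" by (simp add: one_pCons eval_at_pCons h_1)

lemma eval_at_add: "eval_at x (p + q) = eval_at x p + eval_at x q"
  by (induction p q rule: poly_induct2) (simp_all add: eval_at_pCons h_add algebra_simps)

lemma eval_at_smult: "eval_at x (smult c p) = h c * eval_at x p"
  by (induction p) (simp_all add: eval_at_pCons h_mult algebra_simps)

lemma eval_at_mult: "eval_at x (p * q) = eval_at x p * eval_at x q"
  by (induction p) (simp_all add: eval_at_pCons eval_at_add eval_at_smult algebra_simps)

lemma eval_at_diff: "eval_at x (p - q) = eval_at x p - eval_at x q"
  using eval_at_add[of x "p - q" q] by simp

lemma eval_at_power: "eval_at x (p ^ n) = eval_at x p ^ n"
  by (induction n) (simp_all add: eval_at_mult)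

lemma eval_at_sum: "eval_at x (sum f I) = (\<Sum>i\<in>I. eval_at x (f i))"
  by (induction I rule: infinite_finite_induct) (simp_all add: eval_at_add)

lemma eval_at_monom: "eval_at x (monom c n) = h c * x ^ n"
  by (simp add: eval_at_def map_poly_monom poly_monom)

lemma coeff_hom_eval_at: "coeff_hom (eval_at x)"
  by unfold_locales (simp_all add: eval_at_add eval_at_mult)

end

text \<open>cosh(z/2)^2\<close>
definition ychz :: "complex fls" where "ychz = (chz 1 + 2) / 4"

lemma ez_inv: "ez (-1) * ez 1 = 1" by (simp add: ez_0 flip: ez_add)

lemma ychz_chz: "4 * ychz = chz 1 + 2"
  unfolding ychz_def times_divide_eq_right by (rule nonzero_mult_div_cancel_left) simp

lemma chz_1: "chz 1 = 4 * ychz - 2" by (simp add: ychz_chz)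

lemma chz_Suc_Suc: "chz (Suc (Suc d)) = chz 1 * chz (Suc d) - chz d"
proof -
  have "1 + of_nat (Suc d) = (of_nat (Suc (Suc d)) :: complex)" "1 + - of_nat (Suc d) = (- of_nat d :: complex)"
    "-1 + of_nat (Suc d) = (of_nat d :: complex)" "-1 + - of_nat (Suc d) = (- of_nat (Suc (Suc d)) :: complex)"
    by simp_all
  then have "ez 1 * ez (of_nat (Suc d)) = ez (of_nat (Suc (Suc d)))" "ez 1 * ez (- of_nat (Suc d)) = ez (- of_nat d)"
    "ez (-1) * ez (of_nat (Suc d)) = ez (of_nat d)" "ez (-1) * ez (- of_nat (Suc d)) = ez (- of_nat (Suc (Suc d)))"
    by (metis ez_add)+
  moreover have "chz 1 = ez 1 + ez (-1)" by (simp add: chz_def)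
  ultimately show ?thesis by (simp add: chz_def[of "Suc _"] chz_def[of d] algebra_simps del: of_nat_Suc)
qed

lemma cothz_mult: "cothz * (ez 1 - 1) = ez 1 + 1"
  using ez1_neq_1 by (simp add: cothz_def)

lemma ychz_deriv: "cothz * fls_deriv ychz = ychz"
proof -
  have "fls_deriv (4 * ychz) = fls_deriv (chz 1 + 2)" by (simp only: ychz_chz)
  then have d: "4 * fls_deriv ychz = ez 1 - ez (-1)"
    by (simp add: chz_def ez_deriv)
  have "(ez 1 - 1) * (4 * (cothz * fls_deriv ychz)) = (cothz * (ez 1 - 1)) * (4 * fls_deriv ychz)"
    by (simp add: algebra_simps)
  also have "\<dots> = (ez 1 - 1) * (ez 1 + ez (-1) + 2) + 2 * (1 - ez (-1) * ez 1)"
    unfolding d cothz_mult by (simp add: algebra_simps)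
  also have "\<dots> = (ez 1 - 1) * (4 * ychz)" unfolding ychz_chz by (simp add: ez_inv chz_def)
  finally show ?thesis using ez1_neq_1 by simp
qed

lemma cothz_nonzero: "cothz \<noteq> 0"
proof
  assume "cothz = 0"
  then have "ez 1 + 1 = 0" using cothz_mult by simp
  then have "fls_nth (ez 1 + 1) 0 = 0" by (metis fls_zero_nth)
  then show False by (simp add: ez_nth)
qed

text \<open>A derivative has residue 0; by T' = (1 - T^2)/2 and y' = y/T the derivative of T^(2m+2)
  y^i is T^(2m+1) y^i times (m + 1)(1 - T^2) + i.\<close>

lemma residue_cothz_ychz_Suc:
  "of_nat (Suc m) * fls_residue (cothz ^ (2 * Suc m + 1) * ychz ^ i) =
   of_nat (Suc m + i) * fls_residue (cothz ^ (2 * m + 1) * ychz ^ i)"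
proof -
  let ?T = cothz and ?y = ychz
  have dT: "2 * fls_deriv ?T = 1 - ?T ^ 2" by (simp add: cothz_deriv)
  have "fls_deriv (?T ^ (2 * Suc m)) = of_nat (Suc m) * ?T ^ (2 * m + 1) * (2 * fls_deriv ?T)"
    by (simp add: fls_deriv_power algebra_simps del: power_Suc)
  also have "\<dots> = of_nat (Suc m) * (?T ^ (2 * m + 1) - ?T ^ (2 * Suc m + 1))"
    unfolding dT by (simp add: algebra_simps power2_eq_square)
  finally have 1: "fls_deriv (?T ^ (2 * Suc m)) = of_nat (Suc m) * (?T ^ (2 * m + 1) - ?T ^ (2 * Suc m + 1))" .
  have "?T ^ (2 * Suc m) * fls_deriv (?y ^ i) = of_nat i * ?T ^ (2 * m + 1) * (?y ^ (i - 1) * (?T * fls_deriv ?y))"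
    by (simp add: fls_deriv_power algebra_simps)
  also have "\<dots> = of_nat i * (?T ^ (2 * m + 1) * ?y ^ i)"
    unfolding ychz_deriv by (cases i) (simp_all add: algebra_simps)
  finally have 2: "?T ^ (2 * Suc m) * fls_deriv (?y ^ i) = of_nat i * (?T ^ (2 * m + 1) * ?y ^ i)" .
  have "fls_deriv (?T ^ (2 * Suc m) * ?y ^ i) =
     of_nat (Suc m + i) * (?T ^ (2 * m + 1) * ?y ^ i) - of_nat (Suc m) * (?T ^ (2 * Suc m + 1) * ?y ^ i)"
    unfolding fls_deriv_mult 1 2 by (simp add: algebra_simps)
  then have "fls_residue (of_nat (Suc m + i) * (?T ^ (2 * m + 1) * ?y ^ i) - of_nat (Suc m) * (?T ^ (2 * Suc m + 1) * ?y ^ i)) = 0"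
    by (metis fls_residue_deriv)
  then show ?thesis by (simp add: fls_mult_of_nat_nth del: of_nat_Suc of_nat_add power_Suc)
qed

text \<open>For m = 0 the only pole is the simple one of T, with residue 2, while y has constant
  term 1. The recursion in m is that of binom(m + i, i).\<close>

lemma residue_cothz_ychz: "fls_residue (cothz ^ (2 * m + 1) * ychz ^ i) = 2 * of_nat ((m + i) choose i)"
proof (induction m)
  case 0
  define Y :: "complex fps" where "Y = fps_const (1/4) * (fps_exp 1 + fps_exp (-1) + 2)"
  have "4 * ychz = 4 * fps_to_fls Y"
    unfolding ychz_chz by (rule fls_eqI) (simp add: chz_def ez_def Y_def numeral_fps_const)
  then have y: "ychz = fps_to_fls Y" by simp
  have "cothz * ychz ^ i = fps_to_fls (Y ^ i) + 2 * fls_shift 1 (fps_to_fls (bern * Y ^ i))"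
    unfolding cothz_bern y by (simp add: algebra_simps fps_to_fls_power fls_times_fps_to_fls fls_shifted_times_simps)
  moreover have "fps_nth Y 0 = 1" by (simp add: Y_def numeral_fps_const)
  ultimately show ?case by (simp add: bern_values fps_power_zeroth)
next
  case (Suc m)
  have "of_nat (Suc m) * fls_residue (cothz ^ (2 * Suc m + 1) * ychz ^ i) =
     (of_nat (Suc m + i) * (2 * of_nat ((m + i) choose i)) :: complex)"
    unfolding residue_cothz_ychz_Suc Suc.IH ..
  also have "(m + i) choose i = (m + i) choose m"
    using binomial_symmetric[of m "m + i"] by simp
  also have "of_nat (Suc m + i) * (2 * of_nat ((m + i) choose m)) = (2 * of_nat (Suc (m + i) * ((m + i) choose m)) :: complex)"
    by (simp only: of_nat_mult add_Suc mult_ac)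
  also have "Suc (m + i) * ((m + i) choose m) = (Suc (m + i) choose Suc m) * Suc m"
    by (rule Suc_times_binomial_eq)
  also have "Suc (m + i) choose Suc m = (Suc m + i) choose i"
    using binomial_symmetric[of "Suc m" "Suc m + i"] by simp
  finally have "of_nat (Suc m) * fls_residue (cothz ^ (2 * Suc m + 1) * ychz ^ i) =
     of_nat (Suc m) * (2 * of_nat ((Suc m + i) choose i) :: complex)"
    by (simp add: algebra_simps)
  then show ?case by (simp del: of_nat_Suc)
qed

interpretation fls_const_hom: coeff_hom "fls_const :: complex \<Rightarrow> complex fls"
  by unfold_locales (simp_all add: fls_plus_const)

abbreviation yeval :: "complex poly \<Rightarrow> complex fls" where
  "yeval \<equiv> fls_const_hom.eval_at ychz"

lemmas yeval_pCons = fls_const_hom.eval_at_pCons[of ychz]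
  and yeval_mult = fls_const_hom.eval_at_mult[of ychz]
  and yeval_smult = fls_const_hom.eval_at_smult[of ychz]
  and yeval_diff = fls_const_hom.eval_at_diff[of ychz]
  and yeval_sum = fls_const_hom.eval_at_sum[of ychz]

lemma yeval_altdef:
  assumes "degree p \<le> n" shows "yeval p = (\<Sum>i\<le>n. fls_const (coeff p i) * ychz ^ i)"
proof -
  have d: "degree (map_poly fls_const p) \<le> degree p" by (rule map_poly_degree_leq)
  have "yeval p = (\<Sum>i\<le>n. coeff (map_poly fls_const p) i * ychz ^ i)"
    unfolding fls_const_hom.eval_at_def poly_altdef
    by (rule sum.mono_neutral_left) (use assms d in \<open>auto simp: coeff_eq_0\<close>)
  then show ?thesis by (simp add: coeff_map_poly)
qed

lemma residue_cothz_yeval: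
  assumes "degree p \<le> n"
  shows "fls_residue (cothz ^ (2 * m + 1) * yeval p) = 2 * (\<Sum>i\<le>n. coeff p i * of_nat ((m + i) choose i))"
proof -
  have "cothz ^ (2 * m + 1) * yeval p = (\<Sum>i\<le>n. fls_const (coeff p i) * (cothz ^ (2 * m + 1) * ychz ^ i))"
    unfolding yeval_altdef[OF assms] sum_distrib_left by (intro sum.cong refl) (simp only: mult_ac)
  then have "fls_residue (cothz ^ (2 * m + 1) * yeval p) = (\<Sum>i\<le>n. coeff p i * fls_residue (cothz ^ (2 * m + 1) * ychz ^ i))"
    by (simp add: fls_sum_nth)
  then show ?thesis unfolding residue_cothz_ychz by (simp add: sum_distrib_left mult_ac)
qed

text \<open>This is 2 T_d(2 y - 1) with T_d the Chebyshev polynomial of the first kind, as cosh z =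
  2 y - 1.\<close>

fun cheb :: "nat \<Rightarrow> complex poly" where
  "cheb 0 = [:2:]"
| "cheb (Suc 0) = [:-2, 4:]"
| "cheb (Suc (Suc d)) = [:-2, 4:] * cheb (Suc d) - cheb d"

lemma yeval_cheb: "yeval (cheb d) = chz d"
proof (induction d rule: cheb.induct)
  case 1
  show ?case by (simp add: yeval_pCons chz_def ez_0)
next
  case 2
  show ?case using chz_1 by (simp add: yeval_pCons algebra_simps)
next
  case (3 d)
  have "yeval [:-2, 4:] = chz 1"
    using chz_1 by (simp add: yeval_pCons algebra_simps)
  then show ?case unfolding cheb.simps yeval_diff yeval_mult 3 chz_Suc_Suc by simp
qed

lemma degree_cheb: "degree (cheb d) \<le> d"
proof (induction d rule: cheb.induct)
  case (3 d)
  have "degree ([:-2, 4:] * cheb (Suc d)) \<le> Suc (Suc d)"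
    by (rule order_trans[OF degree_mult_le]) (use 3 in simp)
  then show ?case using 3 by (simp only: cheb.simps) (rule degree_diff_le, auto)
qed simp_all

text \<open>The series V = wp - 4 G2 - T^2/4 with its q-coefficients written as polynomials in
  y.\<close>

definition vpoly :: "complex poly fps" where
  "vpoly = Abs_fps (\<lambda>n. if n = 0 then 0 else (\<Sum>d | d dvd n. smult (of_nat d) (cheb d - [:6:])))"

lemma degree_vpoly: "degree (fps_nth vpoly n) \<le> n"
proof (cases "n = 0")
  case False
  have "degree (smult (of_nat d) (cheb d - [:6:])) \<le> n" if "d dvd n" for d
  proof -
    have "degree (cheb d) \<le> n" using degree_cheb[of d] dvd_imp_le[OF that] False by simp
    then show ?thesis by (intro order_trans[OF degree_smult_le] degree_diff_le) auto
  qed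
  then show ?thesis using False by (auto simp: vpoly_def intro!: degree_sum_le)
qed (simp add: vpoly_def)

lemma degree_vpoly_power: "degree (fps_nth (vpoly ^ j) n) \<le> n"
proof (induction j arbitrary: n)
  case (Suc j)
  have "degree (fps_nth vpoly i * fps_nth (vpoly ^ j) (n - i)) \<le> n" if "i \<le> n" for i
    using that order_trans[OF degree_mult_le add_mono[OF degree_vpoly[of i] Suc.IH[of "n - i"]]] by simp
  then show ?case unfolding power_Suc fps_mult_nth by (intro degree_sum_le) auto
qed (simp add: fps_one_nth)

definition yeval_fps :: "complex poly fps \<Rightarrow> complex fls fps" where
  "yeval_fps f = Abs_fps (\<lambda>n. yeval (fps_nth f n))"

lemma yeval_fps_mult: "yeval_fps (f * g) = yeval_fps f * yeval_fps g"
  by (rule fps_ext) (simp add: yeval_fps_def fps_mult_nth yeval_sum yeval_mult)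

lemma yeval_fps_power: "yeval_fps (f ^ n) = yeval_fps f ^ n"
  by (induction n) (auto simp: yeval_fps_mult, auto simp: yeval_fps_def fps_eq_iff)

lemma yeval_fps_vpoly: "yeval_fps vpoly = lambert_series (\<lambda>d. of_nat d * (chz d - 6))"
proof -
  have "yeval [:6:] = 6" by (simp add: yeval_pCons)
  then show ?thesis
    by (intro fps_ext) (simp add: yeval_fps_def vpoly_def lambert_series_def yeval_sum yeval_smult yeval_diff yeval_cheb fls_of_nat)
qed

lemma fls_const_gbinomial: "(fls_const a :: complex fls) gchoose j = fls_const (a gchoose j)"
proof -
  have "(\<Prod>i=0..<j. fls_const a - of_nat i) = fls_const (\<Prod>i=0..<j. a - of_nat i)"
    by (induction j) (simp_all add: fls_of_nat fls_minus_const)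
  moreover have "fact j = fls_const (fact j :: complex)"
    by (metis fls_of_nat of_nat_fact)
  moreover have "fls_const (p / f) * fls_const f = fls_const p" if "f \<noteq> 0" for p f :: complex
    using that by simp
  ultimately show ?thesis
    by (simp add: gbinomial_prod_rev nonzero_divide_eq_eq)
qed

definition binom_poly :: "nat \<Rightarrow> complex poly" where
  "binom_poly i = smult (1 / fact i) (\<Prod>l=1..i. [:of_nat l, 1:])"

lemma degree_prod_linear: "finite I \<Longrightarrow> degree (\<Prod>l\<in>I. [:f l, 1:] :: complex poly) = card I"
  by (induction I rule: finite_induct) (auto simp: degree_mult_eq simp del: mult_pCons_left)

lemma degree_binom_poly: "degree (binom_poly i) = i"
  by (simp add: binom_poly_def degree_prod_linear)

lemma poly_binom_poly: "poly (binom_poly i) (of_nat m) = of_nat ((m + i) choose i)"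
proof -
  have "(\<Prod>l=1..i. of_nat l + of_nat m) * fact m = (fact (m + i) :: complex)"
  proof (induction i)
    case (Suc i)
    have "(\<Prod>l=1..Suc i. of_nat l + of_nat m) * fact m =
        (of_nat (Suc i) + of_nat m) * ((\<Prod>l=1..i. of_nat l + of_nat m) * fact m :: complex)"
      by (simp add: mult_ac)
    also have "\<dots> = fact (m + Suc i)" unfolding Suc.IH by (simp add: add_ac)
    finally show ?case .
  qed simp
  then show ?thesis
    by (simp add: binom_poly_def poly_prod binomial_fact field_simps)
qed

definition gbinom_poly :: "nat \<Rightarrow> complex poly" where
  "gbinom_poly j = smult (1 / fact j) (\<Prod>l=0..<j. [:1/2 - of_nat l, 1:])"

lemma degree_gbinom_poly: "degree (gbinom_poly j) = j"
  by (simp add: gbinom_poly_def degree_prod_linear)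

lemma poly_gbinom_poly: "poly (gbinom_poly j) x = (x + 1/2) gchoose j"
  by (simp add: gbinom_poly_def poly_prod gbinomial_prod_rev algebra_simps)

text \<open>Half the residue of T^(2(k-j)+1) times the q^n-coefficient of V^j, as a polynomial in k;
  the composition puts m = k - j into the residue formula.\<close>

definition res_poly :: "nat \<Rightarrow> nat \<Rightarrow> complex poly" where
  "res_poly n j = (\<Sum>i\<le>n. smult (coeff (fps_nth (vpoly ^ j) n) i) (pcompose (binom_poly i) [:- of_nat j, 1:]))"

lemma poly_res_poly:
  assumes "j \<le> k"
  shows "2 * poly (res_poly n j) (of_nat k) = fls_residue (cothz ^ (2 * (k - j) + 1) * yeval (fps_nth (vpoly ^ j) n))"
proof -
  have "- of_nat j + of_nat k = (of_nat (k - j) :: complex)" using assms by (simp add: of_nat_diff)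
  then show ?thesis
    unfolding residue_cothz_yeval[OF degree_vpoly_power]
    by (simp add: res_poly_def poly_sum poly_pcompose poly_binom_poly)
qed

definition A_poly :: "nat \<Rightarrow> complex poly" where
  "A_poly n = (\<Sum>j\<le>n. smult (4 ^ j) (gbinom_poly j) * res_poly n j)"

lemma degree_res_poly: "degree (res_poly n j) \<le> n"
  unfolding res_poly_def
  by (intro degree_sum_le order_trans[OF degree_smult_le]) (auto simp: degree_binom_poly degree_pcompose)

lemma degree_res_poly_self: "degree (res_poly n n) = n"
proof -
  let ?c = "\<lambda>i. coeff (fps_nth (vpoly ^ n) n) i"
  let ?q = "\<lambda>i. smult (?c i) (pcompose (binom_poly i) [:- of_nat n, 1:])"
  \<comment> \<open>V starts at q, so the q^n-coefficient of V^n is the n-th power of its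
    q-coefficient \<open>cheb 1\<close> - 6 = 4 y - 8, of exact degree n in y.\<close>
  have "fps_nth vpoly 1 = [:-8, 4:]"
    by (simp add: vpoly_def)
  then have v: "fps_nth (vpoly ^ n) n = [:-8, 4:] ^ n"
    by (simp add: startsby_zero_power_nth_same vpoly_def)
  have "degree ([:-8, 4:] ^ n :: complex poly) = n" by (simp add: degree_power_eq)
  then have "?c n = lead_coeff ([:-8, 4:] ^ n)" by (simp add: v)
  then have c: "?c n \<noteq> 0" by (simp add: lead_coeff_power)
  have "degree (?q n) = n" using c by (simp add: degree_binom_poly degree_pcompose)
  moreover have "res_poly n n = (\<Sum>i<n. ?q i) + ?q n"
    by (simp add: res_poly_def flip: lessThan_Suc_atMost)
  moreover have "n = 0 \<or> degree (\<Sum>i<n. ?q i) < n"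
  proof (cases n)
    case (Suc m)
    then have "degree (\<Sum>i<n. ?q i) \<le> m"
      by (intro degree_sum_le order_trans[OF degree_smult_le]) (auto simp: degree_binom_poly degree_pcompose)
    then show ?thesis using Suc by simp
  qed simp
  ultimately show ?thesis by (cases "n = 0") (auto simp: degree_add_eq_right)
qed

text \<open>The j-th summand has degree at most j + n, so only j = n can reach 2 n, and there both
  factors have exact degree n.\<close>

lemma degree_A_poly: "degree (A_poly n) = 2 * n"
proof -
  let ?q = "\<lambda>j. smult (4 ^ j) (gbinom_poly j) * res_poly n j"
  have nz: "res_poly n n \<noteq> 0 \<and> gbinom_poly n \<noteq> 0 \<or> n = 0"
    using degree_res_poly_self[of n] degree_gbinom_poly[of n] by auto
  have "A_poly n = (\<Sum>j<n. ?q j) + ?q n"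
    by (simp add: A_poly_def flip: lessThan_Suc_atMost)
  moreover have "n = 0 \<or> degree (\<Sum>j<n. ?q j) < 2 * n"
  proof (cases n)
    case (Suc m)
    have "degree (?q j) \<le> 2 * n - 1" if "j < n" for j
    proof -
      have "degree (?q j) \<le> degree (smult (4 ^ j) (gbinom_poly j)) + degree (res_poly n j)"
        by (rule degree_mult_le)
      also have "\<dots> \<le> j + n" using degree_res_poly[of n j] by (simp add: degree_gbinom_poly)
      finally show ?thesis using that by simp
    qed
    then have "degree (\<Sum>j<n. ?q j) \<le> 2 * n - 1"
      by (intro degree_sum_le) auto
    then show ?thesis using Suc by simp
  qed simp
  moreover have "degree (?q n) = 2 * n"
  proof (cases "n = 0")
    case True
    then show ?thesis using degree_res_poly_self[of 0] degree_gbinom_poly[of 0]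
      by (auto intro!: order_antisym order_trans[OF degree_mult_le])
  next
    case False
    then show ?thesis using nz by (subst degree_mult_eq) (auto simp: degree_gbinom_poly degree_res_poly_self)
  qed
  ultimately show ?thesis by (cases "n = 0") (auto simp: degree_add_eq_right)
qed

definition Yq :: "complex fls fps" where
  "Yq = fps_const (4 / cothz ^ 2) * yeval_fps vpoly"

lemma Yq_nth_0: "fps_nth Yq 0 = 0" by (simp add: Yq_def yeval_fps_def vpoly_def)

lemma qswap_wpm_Yq: "qswap wpm = fps_const (cothz / 2) ^ 2 * (1 + Yq)"
proof -
  have "fps_const (cothz / 2) ^ 2 * Yq = fps_const ((cothz / 2) ^ 2 * (4 / cothz ^ 2)) * yeval_fps vpoly"
    by (simp add: Yq_def fps_const_power flip: fps_const_mult mult.assoc)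
  also have "(cothz / 2) ^ 2 * (4 / cothz ^ 2) = 1" using cothz_nonzero by (simp add: power_divide)
  finally show ?thesis unfolding qswap_wpm yeval_fps_vpoly[symmetric]
    by (simp add: distrib_left fps_const_power power_divide)
qed

text \<open>Both sides have the same square; the coefficient of z^(-1) at q^0, which is 1 for
  \<open>sqrt_wpm\<close> and for coth(z/2)/2, decides the sign.\<close>

lemma qswap_sqrt_wpm: "qswap sqrt_wpm = fps_const (cothz / 2) * (fps_binomial (1/2) oo Yq)"
proof -
  let ?B = "fps_binomial (1/2) oo Yq"
  have "?B ^ 2 = (fps_binomial (1/2) * fps_binomial (1/2)) oo Yq"
    by (simp add: power2_eq_square fps_compose_mult_distrib Yq_nth_0)
  also have "\<dots> = 1 + Yq"
    by (simp add: fps_binomial_add_mult[symmetric] fps_binomial_1 fps_compose_add_distrib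
        fps_X_fps_compose_startby0[OF Yq_nth_0])
  finally have "(fps_const (cothz / 2) * ?B) ^ 2 = qswap wpm"
    by (simp add: power_mult_distrib qswap_wpm_Yq)
  also have "\<dots> = qswap sqrt_wpm ^ 2"
  proof -
    have "sqrt_wpm ^ 2 = wpm" unfolding sqrt_wpm_Uz by (rule shift_Uz_square)
    then show ?thesis by (simp flip: qswap_power)
  qed
  finally have "qswap sqrt_wpm ^ 2 = (fps_const (cothz / 2) * ?B) ^ 2" ..
  then have "qswap sqrt_wpm = fps_const (cothz / 2) * ?B \<or> qswap sqrt_wpm = - (fps_const (cothz / 2) * ?B)"
    by (simp only: power2_eq_iff)
  then consider "qswap sqrt_wpm = fps_const (cothz / 2) * ?B" | "qswap sqrt_wpm = - (fps_const (cothz / 2) * ?B)"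
    by blast
  then show ?thesis
  proof cases
    case 2
    have "fls_nth (fps_nth (qswap sqrt_wpm) 0) (-1) = 1"
      by (simp add: qswap_nth sqrt_wpm_Uz Uz_nth_0)
    moreover have "fps_nth (qswap sqrt_wpm) 0 = - (cothz / 2)" by (simp add: 2)
    moreover have "2 * fls_nth (cothz / 2) (-1) = 2"
    proof -
      have "2 * fls_nth (cothz / 2) (-1) = fls_nth (2 * (cothz / 2)) (-1)" by (rule fls_mult_of_numeral_nth[symmetric])
      also have "2 * (cothz / 2) = cothz" by simp
      finally show ?thesis by (simp add: cothz_bern bern_values)
    qed
    ultimately show ?thesis by simp
  qed
qed

lemma qswap_wpm_power: "qswap (wpm ^ k * sqrt_wpm) =
    fps_const (cothz / 2) ^ (2 * k + 1) * (fps_binomial (of_nat k + 1/2) oo Yq)"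
proof -
  have "(1 + Yq) ^ k = (fps_binomial (of_nat k) oo Yq)"
    by (simp add: fps_binomial_of_nat fps_compose_power[symmetric] fps_compose_add_distrib Yq_nth_0
        fps_X_fps_compose_startby0[OF Yq_nth_0])
  then have a: "(1 + Yq) ^ k * (fps_binomial (1/2) oo Yq) = (fps_binomial (of_nat k + 1/2) oo Yq)"
    by (simp add: fps_binomial_add_mult fps_compose_mult_distrib Yq_nth_0)
  have b: "(c ^ 2 * x) ^ k * (c * b) = c ^ (2 * k + 1) * (x ^ k * b)" for c x b :: "complex fls fps"
    by (simp add: power_mult_distrib power_mult)
  show ?thesis
    unfolding qswap_mult qswap_power qswap_wpm_Yq qswap_sqrt_wpm b a ..
qed

text \<open>The assumption n <= k keeps the exponent 2 (k - j) + 1 positive for all j <= n, as the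
  residue formula requires.\<close>

lemma A_nth:
  assumes "n \<le> k"
  shows "fps_nth (A k) n = poly (A_poly n) (of_nat k) / ((-4) ^ k * of_nat (odd_dfact k))"
proof -
  have half: "of_nat k + 1/2 = fls_const (of_nat k + 1/2 :: complex)"
  proof -
    have "2 * fls_const (1/2) = (1 :: complex fls)" by (simp add: fls_eq_iff)
    then have "fls_const (1/2) = (1/2 :: complex fls)" by (simp add: field_simps)
    then show ?thesis by (simp add: fls_of_nat flip: fls_plus_const)
  qed
  have Yp: "fps_nth (Yq ^ j) n = (4 / cothz ^ 2) ^ j * yeval (fps_nth (vpoly ^ j) n)" for j
    by (simp add: Yq_def power_mult_distrib fps_const_power flip: yeval_fps_power) (simp add: yeval_fps_def)
  have "fls_residue (wpm ^ k * sqrt_wpm) = fls_nth (wpm ^ k * sqrt_wpm) (-1)" by (simp only: fls_residue_def)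
  then have "fps_nth (fls_residue (wpm ^ k * sqrt_wpm)) n = fls_nth (fps_nth (qswap (wpm ^ k * sqrt_wpm)) n) (-1)"
    by (simp only: qswap_nth)
  also have "fps_nth (qswap (wpm ^ k * sqrt_wpm)) n =
     (\<Sum>j\<le>n. (cothz / 2) ^ (2 * k + 1) * (fls_const ((of_nat k + 1/2) gchoose j) * ((4 / cothz ^ 2) ^ j * yeval (fps_nth (vpoly ^ j) n))))"
    unfolding qswap_wpm_power half fps_const_power
    by (simp only: fps_mult_left_const_nth fps_compose_nth fps_binomial_nth fls_const_gbinomial Yp sum_distrib_left atMost_atLeast0)
  also have "fls_nth \<dots> (-1) = (\<Sum>j\<le>n. poly (smult (4 ^ j) (gbinom_poly j) * res_poly n j) (of_nat k) / 4 ^ k)"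
    unfolding fls_sum_nth
  proof (intro sum.cong refl)
    fix j assume j: "j \<in> {..n}"
    let ?v = "yeval (fps_nth (vpoly ^ j) n)"
    let ?g = "(of_nat k + 1/2 :: complex) gchoose j"
    obtain m where k: "k = m + j" using j assms by (metis atMost_iff le_add_diff_inverse2 le_trans)
    have "cothz ^ (2 * k + 1) = cothz ^ (2 * m + 1) * (cothz ^ 2) ^ j"
      by (simp add: k power_add power_mult distrib_left)
    moreover have "(cothz ^ 2) ^ j * (1 / cothz ^ 2) ^ j = 1"
      using cothz_nonzero by (simp flip: power_mult_distrib)
    ultimately have T: "cothz ^ (2 * k + 1) * (1 / cothz ^ 2) ^ j = cothz ^ (2 * (k - j) + 1)"
      by (simp only: mult.assoc) (simp add: k)
    \<comment> \<open>The factor 2 in the residues cancels against 2^(2k+1) and leaves 4^k.\<close>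
    have 1: "(cothz / 2) ^ (2 * k + 1) * (2 * 4 ^ k) = cothz ^ (2 * k + 1)"
      by (simp add: power_divide power_mult)
    have 2: "(4 / cothz ^ 2) ^ j = 4 ^ j * (1 / cothz ^ 2) ^ j"
      by (simp add: power_divide)
    have "(2 * 4 ^ k) * ((cothz / 2) ^ (2 * k + 1) * (fls_const ?g * ((4 / cothz ^ 2) ^ j * ?v)))
      = ((cothz / 2) ^ (2 * k + 1) * (2 * 4 ^ k)) * (fls_const ?g * ((4 / cothz ^ 2) ^ j * ?v))"
      by (simp only: mult_ac)
    also have "\<dots> = 4 ^ j * (fls_const ?g * (cothz ^ (2 * k + 1) * (1 / cothz ^ 2) ^ j * ?v))"
      unfolding 1 2 by (simp only: mult_ac)
    also have "\<dots> = 4 ^ j * (fls_const ?g * (cothz ^ (2 * (k - j) + 1) * ?v))"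
      unfolding T ..
    finally have e: "(2 * 4 ^ k) * ((cothz / 2) ^ (2 * k + 1) * (fls_const ?g * ((4 / cothz ^ 2) ^ j * ?v)))
      = 4 ^ j * (fls_const ?g * (cothz ^ (2 * (k - j) + 1) * ?v))" .
    have "fls_const (2 * 4 ^ k) * ((cothz / 2) ^ (2 * k + 1) * (fls_const ?g * ((4 / cothz ^ 2) ^ j * ?v)))
       = fls_const (4 ^ j * ?g) * (cothz ^ (2 * (k - j) + 1) * ?v)"
    proof -
      have "fls_const (4 ^ i) = (4 ^ i :: complex fls)" for i
        by (metis fls_of_nat of_nat_power of_nat_numeral)
      then have "fls_const (2 * 4 ^ k) = (2 * 4 ^ k :: complex fls)" "fls_const (4 ^ j * ?g) = 4 ^ j * fls_const ?g"
        by (simp_all flip: fls_const_mult_const)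
      then show ?thesis using e by (simp only: mult.assoc)
    qed
    from arg_cong[OF this, of "\<lambda>f. fls_nth f (-1)"] have "(2 * 4 ^ k) * fls_nth ((cothz / 2) ^ (2 * k + 1) * (fls_const ?g * ((4 / cothz ^ 2) ^ j * ?v))) (-1)
       = 4 ^ j * ?g * fls_nth (cothz ^ (2 * (k - j) + 1) * ?v) (-1)"
      by (simp only: fls_mult_const_nth)
    also have "fls_nth (cothz ^ (2 * (k - j) + 1) * ?v) (-1) = 2 * poly (res_poly n j) (of_nat k)"
      using poly_res_poly[of j k n] j assms by simp
    finally show "fls_nth ((cothz / 2) ^ (2 * k + 1) * (fls_const ?g * ((4 / cothz ^ 2) ^ j * ?v))) (-1) =
       poly (smult (4 ^ j) (gbinom_poly j) * res_poly n j) (of_nat k) / 4 ^ k"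
      by (simp add: poly_gbinom_poly field_simps)
  qed
  also have "\<dots> = poly (A_poly n) (of_nat k) / 4 ^ k"
    by (simp add: A_poly_def poly_sum sum_divide_distrib)
  finally have "fps_nth (A k) n = (-1) ^ k / of_nat (odd_dfact k) * (poly (A_poly n) (of_nat k) / 4 ^ k)"
    by (simp add: A_def)
  also have "\<dots> = poly (A_poly n) (of_nat k) / ((-4) ^ k * of_nat (odd_dfact k))"
  proof -
    have "(-4) ^ k = ((-1) ^ k * 4 ^ k :: complex)" by (simp flip: power_mult_distrib)
    moreover have "(-1) ^ k * (-1) ^ k = (1 :: complex)" by (simp flip: power_mult_distrib)
    ultimately show ?thesis by (simp add: divide_simps)
  qed
  finally show ?thesis .
qed

lemma prop_b_A: "prop_b A"
  unfolding prop_b_def using degree_A_poly A_nth by blast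

section \<open>Algebraic independence of $G_2$, $G_4$, $G_6$\<close>

interpretation fps_const_hom: coeff_hom "fps_const :: complex \<Rightarrow> complex fps"
  by unfold_locales simp_all

definition E2 :: "complex fps" where "E2 = fps_const (-24) * G 2"
definition E4 :: "complex fps" where "E4 = fps_const 240 * G 4"
definition E6 :: "complex fps" where "E6 = fps_const (-504) * G 6"

lemma E_nth: "fps_nth E4 0 = 1" "fps_nth E6 0 = 1" "fps_nth E4 1 = 240" "fps_nth E6 1 = -504"
proof -
  have "{d. d dvd Suc 0} = {1}" by auto
  then show "fps_nth E4 0 = 1" "fps_nth E6 0 = 1" "fps_nth E4 1 = 240" "fps_nth E6 1 = -504"
    by (simp_all add: E4_def E6_def G4_eq G6_eq lambert_series_def)
qed

lemma qderiv_const_mult: "qderiv (fps_const c * f) = fps_const c * qderiv f"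
  by (simp add: algebra_simps)

lemma qderiv_mult: "qderiv (f * g) = qderiv f * g + f * qderiv g"
  by (simp add: algebra_simps)

lemma qderiv_E2: "12 * qderiv E2 = E2 ^ 2 - E4"
proof -
  have 1: "12 * (fps_const (-24) * qderiv (G 2)) = (12 * fps_const (-24) * fps_const (5/6)) * G 4 - (12 * fps_const (-24) * 2) * G 2 ^ 2"
    unfolding qderiv_G2 by (simp only: right_diff_distrib mult.assoc)
  have 2: "12 * fps_const (-24) * fps_const (5/6) = - fps_const (240 :: complex)" "12 * fps_const (-24) * 2 = - (fps_const (-24) ^ 2 :: complex fps)"
    by (simp_all add: numeral_fps_const fps_const_power)
  show ?thesis
    unfolding E2_def E4_def qderiv_const_mult 1 2 power_mult_distrib by (simp add: algebra_simps del: fps_const_neg fps_const_mult)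
qed

lemma qderiv_E4: "3 * qderiv E4 = E2 * E4 - E6"
proof -
  have 1: "3 * (fps_const 240 * qderiv (G 4)) = (3 * fps_const 240 * fps_const (7/10)) * G 6 - (3 * fps_const 240 * 8) * (G 2 * G 4)"
    unfolding qderiv_G4 by (simp only: right_diff_distrib mult.assoc)
  have 2: "3 * fps_const 240 * fps_const (7/10) = - fps_const (-504 :: complex)"
    "3 * fps_const 240 * 8 = - (fps_const (-24) * fps_const (240 :: complex))"
    by (simp_all add: numeral_fps_const)
  show ?thesis
    unfolding E2_def E4_def E6_def qderiv_const_mult 1 2 power_mult_distrib by (simp add: algebra_simps del: fps_const_neg fps_const_mult)
qed

lemma qderiv_E6: "2 * qderiv E6 = E2 * E6 - E4 ^ 2"
proof -
  have 1: "2 * (fps_const (-504) * qderiv (G 6)) = (2 * fps_const (-504) * fps_const (400/7)) * G 4 ^ 2 - (2 * fps_const (-504) * 12) * (G 2 * G 6)"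
    unfolding qderiv_G6 by (simp only: right_diff_distrib mult.assoc)
  have 2: "2 * fps_const (-504) * fps_const (400/7) = - (fps_const (240 :: complex) ^ 2)"
    "2 * fps_const (-504) * 12 = - (fps_const (-24) * fps_const (-504 :: complex))"
    by (simp_all add: numeral_fps_const fps_const_power)
  show ?thesis
    unfolding E2_def E4_def E6_def qderiv_const_mult 1 2 power_mult_distrib by (simp add: algebra_simps del: fps_const_neg fps_const_mult)
qed

text \<open>Dividing by powers of r = E4^(1/2) turns a weight-homogeneous relation among
  E2, E4, E6 into a polynomial relation between the two series x and y.\<close>
definition rr :: "complex fps" where "rr = fps_sqrt (1/2) E4"
definition xx :: "complex fps" where "xx = E2 * inverse rr"
definition yy :: "complex fps" where "yy = E6 * inverse rr ^ 3"

lemma rr_square: "rr ^ 2 = E4"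
  unfolding rr_def by (rule fps_sqrt_square) (simp_all add: E_nth)

lemma rr_nth_0: "fps_nth rr 0 = 1" by (simp add: rr_def fps_sqrt_nth_0)

lemma rr_nonzero: "rr \<noteq> 0" using rr_nth_0 by auto

lemma rr_inverse: "inverse rr * rr = 1"
  by (rule inverse_mult_eq_1) (simp add: rr_nth_0)

lemma E2_xx: "E2 = xx * rr"
  by (simp add: xx_def rr_inverse mult.assoc)

lemma E6_yy: "E6 = yy * rr ^ 3"
proof -
  have "inverse rr ^ 3 * rr ^ 3 = 1" by (simp add: rr_inverse flip: power_mult_distrib)
  then show ?thesis by (simp add: yy_def mult.assoc)
qed

lemma yy_nth_0: "fps_nth yy 0 = 1"
  using E_nth(2) unfolding E6_yy by (simp add: fps_power_zeroth rr_nth_0)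

lemma qderiv_rr: "6 * qderiv rr = rr ^ 2 * (xx - yy)"
proof -
  have "rr * (6 * qderiv rr) = 3 * qderiv (rr ^ 2)"
    by (simp add: power2_eq_square algebra_simps)
  also have "\<dots> = rr * (rr ^ 2 * (xx - yy))"
    unfolding rr_square qderiv_E4 E2_xx E6_yy by (simp add: rr_square[symmetric] algebra_simps power2_eq_square power3_eq_cube)
  finally show ?thesis using rr_nonzero by simp
qed

lemma qderiv_xx: "12 * qderiv xx = rr * (2 * xx * yy - xx ^ 2 - 1)"
proof -
  have "12 * (qderiv xx * rr + xx * qderiv rr) = (xx * rr) ^ 2 - rr ^ 2"
    using qderiv_E2 unfolding E2_xx rr_square[symmetric] qderiv_mult .
  then have "rr * (12 * qderiv xx) = rr * (rr * (2 * xx * yy - xx ^ 2 - 1))"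
    using qderiv_rr by algebra
  then show ?thesis using rr_nonzero by simp
qed

lemma qderiv_yy: "2 * qderiv yy = rr * (yy ^ 2 - 1)"
proof -
  have "qderiv (rr ^ 3) = 3 * rr ^ 2 * qderiv rr" by (simp add: power3_eq_cube power2_eq_square algebra_simps)
  moreover have "2 * (qderiv yy * rr ^ 3 + yy * qderiv (rr ^ 3)) = (xx * rr) * (yy * rr ^ 3) - (rr ^ 2) ^ 2"
    using qderiv_E6 unfolding E2_xx E6_yy rr_square[symmetric] qderiv_mult .
  ultimately have "rr ^ 3 * (2 * qderiv yy) = rr ^ 3 * (rr * (yy ^ 2 - 1))"
    using qderiv_rr by algebra
  then show ?thesis using rr_nonzero by simp
qed

text \<open>A constant y would be 1 by its constant term, giving E4^3 = E6^2; but the coefficients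
  of q are 720 and -1008.\<close>

lemma yy_not_const: "yy \<noteq> fps_const c"
proof
  assume y: "yy = fps_const c"
  have "c = 1" using yy_nth_0 unfolding y by simp
  then have "E6 = rr ^ 3" using y E6_yy by simp
  moreover have "(rr ^ 3) ^ 2 = (rr ^ 2) ^ 3" by (simp flip: power_mult)
  ultimately have "E6 ^ 2 = (rr ^ 2) ^ 3" by metis
  then have "E6 * E6 = E4 * E4 * E4" unfolding rr_square by (simp add: power2_eq_square power3_eq_cube)
  then have "fps_nth (E6 * E6) 1 = fps_nth (E4 * E4 * E4) 1" by simp
  then show False by (simp add: fps_mult_nth E_nth[unfolded One_nat_def])
qed

abbreviation yev :: "complex poly \<Rightarrow> complex fps" where "yev \<equiv> fps_const_hom.eval_at yy"

interpretation yev_hom: coeff_hom yev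
  by (rule fps_const_hom.coeff_hom_eval_at)

abbreviation xyev :: "complex poly poly \<Rightarrow> complex fps" where "xyev \<equiv> yev_hom.eval_at xx"

lemma yev_nth_0: "fps_nth (yev f) 0 = poly f 1"
  by (induction f) (simp_all add: fps_const_hom.eval_at_pCons yy_nth_0)

lemma yev_linear: "yev [:- c, 1:] = yy - fps_const c"
  by (simp add: fps_const_hom.eval_at_pCons flip: fps_const_neg)

text \<open>The constant term of y is 1, so a polynomial not divisible by Y - 1 takes a value with
  nonzero constant term at y; powers of Y - 1 are split off and handled by
  \<open>yy_not_const\<close>.\<close>

lemma yev_nonzero: assumes "f \<noteq> 0" shows "yev f \<noteq> 0"
proof -
  obtain q where f: "f = [:- 1, 1:] ^ order 1 f * q" and "\<not> [:- 1, 1:] dvd q"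
    using order_decomp[OF assms] by blast
  then have "poly q 1 \<noteq> 0" by (simp add: poly_eq_0_iff_dvd)
  then have "yev q \<noteq> 0" using yev_nth_0[of q] by auto
  moreover have "yev [:- 1, 1:] \<noteq> 0" unfolding yev_linear using yy_not_const[of 1] by simp
  ultimately show ?thesis
    by (subst f) (simp only: fps_const_hom.eval_at_mult fps_const_hom.eval_at_power mult_eq_0_iff power_eq_0_iff, simp)
qed

lemma qderiv_yev: "qderiv (yev f) = yev (pderiv f) * qderiv yy"
  by (induction f)
     (simp_all add: fps_const_hom.eval_at_pCons pderiv_pCons fps_const_hom.eval_at_add algebra_simps)

lemma map_poly_pderiv_pCons: "map_poly pderiv (pCons f P) = pCons (pderiv f) (map_poly pderiv P)"
  by (rule map_poly_pCons) simp

lemma qderiv_xyev: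
  "qderiv (xyev P) = xyev (map_poly pderiv P) * qderiv yy + xyev (pderiv P) * qderiv xx"
proof (induction P)
  case (pCons f P)
  have "qderiv (xyev (pCons f P)) = qderiv (yev f) + (qderiv xx * xyev P + xx * qderiv (xyev P))"
    by (simp add: yev_hom.eval_at_pCons algebra_simps)
  then show ?case unfolding qderiv_yev pCons.IH
    by (simp add: yev_hom.eval_at_pCons map_poly_pderiv_pCons pderiv_pCons yev_hom.eval_at_add algebra_simps)
qed simp

text \<open>The vector field 12/r D in the coordinates x and y, plus n x.\<close>
definition xy_deriv :: "nat \<Rightarrow> complex poly poly \<Rightarrow> complex poly poly" where
  "xy_deriv n P = smult [:-6, 0, 6:] (map_poly pderiv P) - pderiv P
     + smult [:0, 2:] (pCons 0 (pderiv P)) + pCons 0 (smult (of_nat n) P - pCons 0 (pderiv P))"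

lemma xyev_xy_deriv:
  assumes "xyev P = 0" shows "xyev (xy_deriv n P) = 0"
proof -
  have 1: "yev [:-6, 0, 6:] = 6 * (yy ^ 2 - 1)" "yev [:0, 2:] = 2 * yy"
    by (simp_all add: fps_const_hom.eval_at_pCons power2_eq_square numeral_fps_const algebra_simps flip: fps_const_neg)
  have 2: "xyev (xy_deriv n P) = yev [:-6, 0, 6:] * xyev (map_poly pderiv P) - xyev (pderiv P)
      + yev [:0, 2:] * (xx * xyev (pderiv P)) - xx * (xx * xyev (pderiv P))"
    using assms by (simp only: xy_deriv_def yev_hom.eval_at_add yev_hom.eval_at_diff yev_hom.eval_at_smult
       yev_hom.eval_at_pCons) simp
  have "rr * xyev (xy_deriv n P) =
     rr * (6 * (yy ^ 2 - 1) * xyev (map_poly pderiv P) + (2 * xx * yy - xx ^ 2 - 1) * xyev (pderiv P))"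
    unfolding 2 1 by (simp add: power2_eq_square algebra_simps)
  also have "\<dots> = 12 * (xyev (map_poly pderiv P) * qderiv yy + xyev (pderiv P) * qderiv xx)"
    using qderiv_xx qderiv_yy by algebra
  also have "\<dots> = 0" using qderiv_xyev[of P] assms by simp
  finally show ?thesis using rr_nonzero by simp
qed

lemma coeff_xy_deriv_0: "coeff (xy_deriv n P) 0 = [:-6, 0, 6:] * pderiv (coeff P 0) - coeff P 1"
  by (simp add: xy_deriv_def coeff_map_poly coeff_pderiv)

lemma coeff_xy_deriv_Suc:
  "coeff (xy_deriv n P) (Suc a) = [:-6, 0, 6:] * pderiv (coeff P (Suc a)) - of_nat (a + 2) * coeff P (a + 2)
     + [:0, 2:] * (of_nat (Suc a) * coeff P (Suc a)) + (of_nat n - of_nat a) * coeff P a"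
  by (cases a) (simp_all add: xy_deriv_def coeff_map_poly coeff_pderiv algebra_simps)

text \<open>This is what n x P is for: the term -x^2 d/dx of the field sends the leading power x^n
  to -n x^(n+1), and n x P cancels that.\<close>

lemma degree_xy_deriv: assumes "degree P = n" shows "degree (xy_deriv n P) \<le> n"
proof (rule degree_le, intro allI impI)
  fix i assume "n < i"
  then obtain a where i: "i = Suc a" "n \<le> a" by (cases i) auto
  have "(of_nat n - of_nat a) * coeff P a = 0" using i assms by (cases "a = n") (auto simp: coeff_eq_0)
  then show "coeff (xy_deriv n P) i = 0" using i assms by (simp add: coeff_xy_deriv_Suc coeff_eq_0)
qed

section \<open>Minimal relations between x and y and their cofactors\<close>

definition xy_minimal :: "complex poly poly \<Rightarrow> bool" where
  "xy_minimal P \<longleftrightarrow> P \<noteq> 0 \<and> xyev P = 0 \<and> (\<forall>Q. Q \<noteq> 0 \<longrightarrow> xyev Q = 0 \<longrightarrow>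
     degree P < degree Q \<or> degree P = degree Q \<and> degree (lead_coeff P) \<le> degree (lead_coeff Q))"

lemma xy_minimal_exists:
  assumes "P \<noteq> 0" "xyev P = 0" shows "\<exists>P. xy_minimal P"
proof -
  define R where "R = (\<lambda>P. P \<noteq> 0 \<and> xyev P = 0)"
  have "R P" using assms by (simp add: R_def)
  then obtain P0 where P0: "R P0" "\<And>Q. R Q \<Longrightarrow> degree P0 \<le> degree Q"
    using ex_has_least_nat[of R P degree] by blast
  then obtain P1 where P1: "R P1" "degree P1 = degree P0"
    "\<And>Q. R Q \<Longrightarrow> degree Q = degree P0 \<Longrightarrow> degree (lead_coeff P1) \<le> degree (lead_coeff Q)"
    using ex_has_least_nat[of "\<lambda>Q. R Q \<and> degree Q = degree P0" P0 "\<lambda>Q. degree (lead_coeff Q)"] by blast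
  then have "xy_minimal P1"
    unfolding xy_minimal_def using P0(2) by (metis R_def le_neq_implies_less)
  then show ?thesis ..
qed

text \<open>The coefficients lie in C[y], not in a field, so the leading coefficient of Q is divided
  with remainder; a nonzero Q - k P would be a relation below P in the order of
  \<open>xy_minimal\<close>.\<close>

lemma xy_minimal_smult:
  assumes P: "xy_minimal P" and Q: "xyev Q = 0" "degree Q \<le> degree P"
  shows "\<exists>k. Q = smult k P"
proof -
  let ?n = "degree P"
  define k where "k = coeff Q ?n div lead_coeff P"
  define R where "R = Q - smult k P"
  have R: "degree R \<le> ?n" "xyev R = 0"
    using Q P by (auto simp: R_def xy_minimal_def yev_hom.eval_at_diff yev_hom.eval_at_smult intro!: degree_diff_le
        order_trans[OF degree_smult_le])
  have c: "coeff R ?n = coeff Q ?n mod lead_coeff P"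
    by (simp add: R_def k_def minus_div_mult_eq_mod)
  have "R = 0"
  proof (rule ccontr)
    assume "R \<noteq> 0"
    then have "degree R = ?n" and le: "degree (lead_coeff P) \<le> degree (lead_coeff R)"
      using P R unfolding xy_minimal_def by (metis leD)+
    then have "coeff Q ?n mod lead_coeff P \<noteq> 0" using c \<open>R \<noteq> 0\<close> by (metis leading_coeff_0_iff)
    moreover have "lead_coeff P \<noteq> 0" using P by (simp add: xy_minimal_def)
    ultimately have "degree (lead_coeff R) < degree (lead_coeff P)"
      using degree_mod_less[of "lead_coeff P" "coeff Q ?n"] c \<open>degree R = ?n\<close> by metis
    then show False using le by simp
  qed
  then show ?thesis by (auto simp: R_def)
qed

text \<open>Otherwise Y - c divides all coefficients; as y - c is not zero, dividing by it leaves a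
  relation whose leading coefficient has smaller degree.\<close>

lemma xy_minimal_specialize:
  assumes P: "xy_minimal P" shows "map_poly (\<lambda>f. poly f c) P \<noteq> 0"
proof
  let ?l = "[:- c, 1:]"
  assume z: "map_poly (\<lambda>f. poly f c) P = 0"
  have "poly (coeff P i) c = 0" for i
  proof -
    have "coeff (map_poly (\<lambda>f. poly f c) P) i = poly (coeff P i) c" by (simp add: coeff_map_poly)
    then show ?thesis using z by simp
  qed
  then have dv: "?l dvd coeff P i" for i by (simp add: poly_eq_0_iff_dvd)
  define R where "R = map_poly (\<lambda>f. f div ?l) P"
  have PR: "P = smult ?l R"
    by (rule poly_eqI) (simp add: R_def coeff_map_poly dv del: mult_pCons_left)
  have "R \<noteq> 0" using PR P by (auto simp: xy_minimal_def)
  have "yev ?l * xyev R = 0"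
    using P PR by (metis xy_minimal_def yev_hom.eval_at_smult)
  moreover have "yev ?l \<noteq> 0" by (rule yev_nonzero) simp
  ultimately have "xyev R = 0" by simp
  moreover have d: "degree R = degree P" by (subst PR) (simp del: smult_pCons)
  ultimately have "degree (lead_coeff P) \<le> degree (lead_coeff R)"
    using P \<open>R \<noteq> 0\<close> unfolding xy_minimal_def by auto
  moreover have "lead_coeff P = ?l * lead_coeff R" unfolding d[symmetric] by (subst PR) (simp only: coeff_smult)
  then have "degree (lead_coeff P) = 1 + degree (lead_coeff R)"
    using \<open>R \<noteq> 0\<close> by (simp add: degree_mult_eq del: mult_pCons_left)
  ultimately show False by simp
qed

text \<open>At the zeros y = 1, -1 of the vector field only the x-direction survives,
  and the order of vanishing at x = y pins down the cofactor.\<close>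
lemma cofactor_value:
  assumes P: "xy_minimal P" and k: "xy_deriv (degree P) P = smult k P" and c: "c ^ 2 = 1"
  shows "poly k c = of_nat (degree P) * c"
proof -
  let ?n = "degree P"
  define p where "p = map_poly (\<lambda>f. poly f c) P"
  have p: "coeff p i = poly (coeff P i) c" for i by (simp add: p_def coeff_map_poly)
  have c2: "poly [:-6, 0, 6:] c = 0" using c by (simp add: power2_eq_square)
  \<comment> \<open>Since c^2 = 1, the y-component of the field vanishes at y = c and the
    x-component 2 c x - x^2 - 1 is -(x - c)^2.\<close>
  have ode: "smult (poly k c) p = pCons 0 (smult (of_nat ?n) p) - [:- c, 1:] ^ 2 * pderiv p"
  proof (rule poly_eqI)
    fix i
    have sq: "[:- c, 1:] ^ 2 * q = q - smult (2 * c) (pCons 0 q) + pCons 0 (pCons 0 q)" for q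
      using c by (simp add: power2_eq_square algebra_simps smult_add_left[symmetric] smult_add_right)
    have "coeff (smult (poly k c) p) i = poly (coeff (xy_deriv ?n P) i) c"
      unfolding k by (simp add: p)
    also have "\<dots> = coeff (pCons 0 (smult (of_nat ?n) p) - [:- c, 1:] ^ 2 * pderiv p) i"
    proof (cases i)
      case 0
      then show ?thesis unfolding sq using c2 by (simp add: coeff_xy_deriv_0 p coeff_pderiv)
    next
      case (Suc a)
      show ?thesis unfolding sq Suc coeff_xy_deriv_Suc using c2
        by (cases a) (simp_all add: p coeff_pderiv algebra_simps)
    qed
    finally show "coeff (smult (poly k c) p) i = coeff (pCons 0 (smult (of_nat ?n) p) - [:- c, 1:] ^ 2 * pderiv p) i" .
  qed
  have "p \<noteq> 0" using xy_minimal_specialize[OF P] by (simp add: p_def)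
  \<comment> \<open>With p = (x - c)^m h, the term (x - c)^2 p' is divisible by (x - c)^(m+1); hence
    n x - k(c) must vanish at x = c, because h does not.\<close>
  then obtain h where h: "p = [:- c, 1:] ^ order c p * h" "\<not> [:- c, 1:] dvd h"
    using order_decomp by blast
  define m where "m = order c p"
  define L where "L = [:- c, 1:]"
  have ph: "p = L ^ m * h" using h by (simp add: m_def L_def)
  have "L * pderiv p = L ^ m * (of_nat m * h + L * pderiv h)"
  proof -
    have "pderiv L = 1" by (simp add: L_def pderiv_pCons)
    then have "L * pderiv (L ^ m) = of_nat m * L ^ m"
      by (induction m) (simp_all add: pderiv_mult algebra_simps)
    moreover have "L * pderiv p = L ^ m * (L * pderiv h) + h * (L * pderiv (L ^ m))"
      unfolding ph by (simp add: pderiv_mult algebra_simps)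
    ultimately show ?thesis by (simp only:) (simp add: algebra_simps)
  qed
  moreover have "pCons 0 (smult (of_nat ?n) p) - smult (poly k c) p = L * (L * pderiv p)"
    unfolding ode L_def power2_eq_square mult.assoc by (simp only: diff_diff_eq2 add_diff_cancel_left')
  moreover have "pCons 0 (smult (of_nat ?n) p) - smult (poly k c) p = [:- poly k c, of_nat ?n:] * p"
    by simp
  ultimately have "L ^ m * ([:- poly k c, of_nat ?n:] * h) = L ^ m * (L * (of_nat m * h + L * pderiv h))"
    unfolding ph by (simp only: mult_ac)
  then have "[:- poly k c, of_nat ?n:] * h = L * (of_nat m * h + L * pderiv h)"
    by (simp add: L_def)
  then have "poly ([:- poly k c, of_nat ?n:] * h) c = 0"
    by (simp only: poly_mult) (simp add: L_def)
  moreover have "poly h c \<noteq> 0" using h by (simp add: poly_eq_0_iff_dvd)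
  ultimately show ?thesis by (simp add: algebra_simps)
qed

text \<open>The leading part of the cofactor is read off from a monomial of maximal weight 6 d + 2 a.\<close>
lemma cofactor_linear:
  assumes "P \<noteq> 0" and k: "xy_deriv (degree P) P = smult k P"
  shows "degree k \<le> 1 \<and> (degree k = 1 \<longrightarrow> (\<exists>N \<ge> 2 * degree P. coeff k 1 = of_nat N))"
proof (cases "degree k = 0")
  case False
  let ?n = "degree P"
  define S where "S = {(a, d). coeff (coeff P a) d \<noteq> 0}"
  define D where "D = Max ((\<lambda>a. degree (coeff P a)) ` {..?n})"
  have "S \<subseteq> {..?n} \<times> {..D}"
  proof (clarsimp simp: S_def)
    fix a d assume nz: "coeff (coeff P a) d \<noteq> 0"
    then have "a \<le> ?n" by (metis coeff_0 le_degree)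
    moreover have "d \<le> degree (coeff P a)" using nz by (rule le_degree)
    moreover have "degree (coeff P a) \<le> D" unfolding D_def using \<open>a \<le> ?n\<close> by (intro Max_ge) auto
    ultimately show "a \<le> ?n \<and> d \<le> D" by simp
  qed
  then have fin: "finite S" by (rule finite_subset) auto
  have lc: "(?n, degree (lead_coeff P)) \<in> S" using assms by (simp add: S_def)
  \<comment> \<open>Give x weight 2 and y weight 6. The terms 6 y^2 d/dy and 2 x y d/dx raise the
    weight by 6 and together multiply x^a y^d by (6 d + 2 a) y; all others raise it by at most
    2.\<close>
  define W where "W = Max ((\<lambda>(a, d). 6 * d + 2 * a) ` S)"
  have W: "6 * d + 2 * a \<le> W" if "(a, d) \<in> S" for a d
    unfolding W_def using fin that by (intro Max_ge) force+
  have "W \<in> (\<lambda>(a, d). 6 * d + 2 * a) ` S"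
    unfolding W_def using fin lc by (intro Max_in) auto
  then obtain a d where ad: "(a, d) \<in> S" "W = 6 * d + 2 * a" by auto
  have big: "coeff (coeff P a') d' = 0" if "6 * d' + 2 * a' > W" for a' d'
    using W[of a' d'] that by (force simp: S_def)
  define e where "e = degree k"
  have e: "e \<ge> 1" using False by (simp add: e_def)
  \<comment> \<open>A lower term of k could reach x^a y^(d+e) only from a monomial of P of weight
    above \<open>W\<close>, so the leading term of k is isolated.\<close>
  have "coeff (k * coeff P a) (d + e) = coeff k e * coeff (coeff P a) d"
  proof -
    have "coeff (k * coeff P a) (d + e) = (\<Sum>i\<le>d + e. coeff k i * coeff (coeff P a) (d + e - i))"
      by (simp add: coeff_mult)
    also have "\<dots> = (\<Sum>i\<in>{e}. coeff k i * coeff (coeff P a) (d + e - i))"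
    proof (rule sum.mono_neutral_right)
      show "\<forall>i\<in>{..d + e} - {e}. coeff k i * coeff (coeff P a) (d + e - i) = 0"
      proof
        fix i assume "i \<in> {..d + e} - {e}"
        then consider "i > e" | "i < e" "6 * (d + e - i) + 2 * a > W" using ad by fastforce
        then show "coeff k i * coeff (coeff P a) (d + e - i) = 0"
          by cases (auto simp: e_def coeff_eq_0 big)
      qed
    qed auto
    finally show ?thesis by simp
  qed
  also have "coeff (k * coeff P a) (d + e) = coeff (coeff (xy_deriv ?n P) a) (d + e)"
    unfolding k by simp
  also have "\<dots> = (if e = 1 then of_nat W * coeff (coeff P a) d else 0)"
  proof -
    obtain j where j: "e = Suc j" using e by (cases e) auto
    have q: "coeff ([:-6, 0, 6:] * pderiv f) (d + e) = 6 * of_nat (d + j) * coeff f (d + j) - 6 * of_nat (d + e + 1) * coeff f (d + e + 1)" for f :: "complex poly"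
      by (cases "d + j") (simp_all add: j coeff_pderiv algebra_simps)
    have z: "coeff (coeff P a) (d + e + 1) = 0" "coeff (coeff P (a + 1)) (d + e) = 0"
      by (rule big; use ad e in simp)+
    have y: "j \<noteq> 0 \<Longrightarrow> coeff (coeff P a) (d + j) = 0" by (rule big) (use ad in simp)
    show ?thesis
    proof (cases a)
      case 0
      show ?thesis unfolding 0 coeff_xy_deriv_0 coeff_diff q using z y ad unfolding 0
        by (cases "j = 0") (simp_all add: j)
    next
      case (Suc a')
      have z': "coeff (coeff P a') (d + e) = 0" by (rule big) (use ad e Suc in simp)
      have ofn: "coeff (of_nat l * f) m = of_nat l * coeff f m" for l m and f :: "complex poly"
        by (simp add: of_nat_poly)
      have "coeff ((of_nat ?n - of_nat a') * coeff P a') (d + e) = 0"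
        by (simp add: left_diff_distrib ofn z')
      then show ?thesis unfolding Suc coeff_xy_deriv_Suc coeff_diff coeff_add q ofn using z y ad unfolding Suc
        by (cases "j = 0") (simp_all add: j ofn algebra_simps)
    qed
  qed
  finally have eq: "coeff k e * coeff (coeff P a) d = (if e = 1 then of_nat W * coeff (coeff P a) d else 0)" ..
  have nz: "coeff (coeff P a) d \<noteq> 0" using ad by (simp add: S_def)
  have "coeff k e \<noteq> 0" using False by (auto simp: e_def)
  then have "e = 1" using eq nz by (auto split: if_splits)
  moreover have "coeff k 1 = of_nat W" using eq nz \<open>e = 1\<close> by simp
  moreover have "2 * ?n \<le> W" using W[OF lc] by simp
  ultimately show ?thesis unfolding e_def by auto
qed simp

lemma xyev_eq_0:
  assumes "xyev P = 0" shows "P = 0"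
proof (rule ccontr)
  assume "P \<noteq> 0"
  then obtain P where P: "xy_minimal P" using xy_minimal_exists assms by blast
  let ?n = "degree P"
  have "xyev P = 0" "P \<noteq> 0" using P by (simp_all add: xy_minimal_def)
  obtain k where k: "xy_deriv ?n P = smult k P"
    using xy_minimal_smult[OF P xyev_xy_deriv[OF \<open>xyev P = 0\<close>] degree_xy_deriv[OF refl]] by blast
  have v: "poly k 1 = of_nat ?n" "poly k (-1) = - of_nat ?n"
    using cofactor_value[OF P k, of 1] cofactor_value[OF P k, of "-1"] by simp_all
  have "?n = 0"
  proof (cases "degree k = 0")
    case True
    then obtain b where "k = [:b:]" by (rule degree_eq_zeroE)
    then have "of_nat ?n = (- of_nat ?n :: complex)" using v by simp
    then have "of_nat (2 * ?n) = (0 :: complex)" by (simp add: eq_neg_iff_add_eq_0)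
    then show ?thesis by simp
  next
    case False
    then have d: "degree k = 1" and "\<exists>N \<ge> 2 * ?n. coeff k 1 = of_nat N"
      using cofactor_linear[OF \<open>P \<noteq> 0\<close> k] by auto
    then obtain N where N: "N \<ge> 2 * ?n" "coeff k 1 = of_nat N" by blast
    have "k = [:coeff k 0, coeff k 1:]"
      by (rule poly_eqI) (use d in \<open>auto simp: coeff_pCons coeff_eq_0 split: nat.splits\<close>)
    then have "poly k 1 - poly k (-1) = 2 * coeff k 1" by (metis (no_types) poly_pCons poly_0 mult_zero_right add_0_right mult_1 mult_minus_left add_diff_cancel_left diff_minus_eq_add mult_2 add_uminus_conv_diff)
    then have "2 * of_nat ?n = (2 * of_nat N :: complex)" using v N by simp
    then have "N = ?n" by simp
    then show ?thesis using N by simp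
  qed
  then obtain f where f: "P = [:f:]" by (rule degree_eq_zeroE)
  then have "f \<noteq> 0" using \<open>P \<noteq> 0\<close> by simp
  moreover have "yev f = 0" using \<open>xyev P = 0\<close> f by (simp add: yev_hom.eval_at_pCons)
  ultimately show False using yev_nonzero by blast
qed

section \<open>Uniqueness\<close>

lemma G_E: "G 2 = fps_const (-1/24) * E2" "G 4 = fps_const (1/240) * E4" "G 6 = fps_const (-1/504) * E6"
  by (simp_all add: E2_def E4_def E6_def flip: mult.assoc)

definition monom_const :: "nat \<times> nat \<times> nat \<Rightarrow> complex" where
  "monom_const = (\<lambda>(a, b, d). (-1/24) ^ a * (1/240) ^ b * (-1/504) ^ d)"

lemma monom_val_E:
  "monom_val (a, b, d) = fps_const (monom_const (a, b, d)) * (E2 ^ a * E4 ^ b * E6 ^ d)"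
  unfolding monom_val_def monom_const_def split_conv G_E power_mult_distrib fps_const_power fps_const_mult[symmetric]
  by (simp only: mult_ac)

text \<open>Dividing by r^(w/2) gives P(x, y) = 0. No cancellation is hidden in P, because the
  weight recovers b from a and d.\<close>

lemma qm_eval_eq_0:
  assumes hom: "qm_homog w c" and z: "qm_eval c = 0"
  shows "c = (\<lambda>_. 0)"
proof (rule ccontr)
  assume "c \<noteq> (\<lambda>_. 0)"
  then obtain a0 b0 d0 where nz: "c (a0, b0, d0) \<noteq> 0" by fastforce
  define S where "S = {x. c x \<noteq> 0}"
  define g where "g = (\<lambda>x. c x * monom_const x)"
  have fin: "finite S" unfolding S_def by (rule qm_homog_finite[OF hom])
  have S: "2 * a + 4 * b + 6 * d = w" if "(a, b, d) \<in> S" for a b d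
    using hom that by (auto simp: qm_homog_def S_def)
  define P where "P = (\<Sum>(a, b, d)\<in>S. monom (monom (g (a, b, d)) d) a)"
  have "qm_eval c = (\<Sum>x\<in>S. fps_const (c x) * monom_val x)"
    by (rule qm_eval_eq[OF fin]) (simp add: S_def)
  also have "\<dots> = (\<Sum>(a, b, d)\<in>S. rr ^ (w div 2) * (fps_const (g (a, b, d)) * yy ^ d * xx ^ a))"
  proof (intro sum.cong refl, clarify)
    fix a b d assume "(a, b, d) \<in> S"
    then have w: "w div 2 = a + 2 * b + 3 * d" using S by fastforce
    have "E2 ^ a * E4 ^ b * E6 ^ d = rr ^ (w div 2) * (yy ^ d * xx ^ a)"
      unfolding E2_xx E6_yy rr_square[symmetric] w power_add power_mult power_mult_distrib by (simp only: mult_ac)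
    then show "fps_const (c (a, b, d)) * monom_val (a, b, d) = rr ^ (w div 2) * (fps_const (g (a, b, d)) * yy ^ d * xx ^ a)"
      unfolding monom_val_E g_def fps_const_mult[symmetric] by (simp only: mult_ac)
  qed
  also have "\<dots> = rr ^ (w div 2) * xyev P"
    by (simp add: P_def yev_hom.eval_at_sum case_prod_beta yev_hom.eval_at_monom fps_const_hom.eval_at_monom sum_distrib_left)
  finally have "xyev P = 0" using z rr_nonzero by simp
  then have "P = 0" by (rule xyev_eq_0)
  have "coeff (coeff P a0) d0 = (\<Sum>x\<in>S. if x = (a0, b0, d0) then g x else 0)"
    unfolding P_def coeff_sum
  proof (intro sum.cong refl, clarify)
    fix a b d assume "(a, b, d) \<in> S"
    moreover have "(a0, b0, d0) \<in> S" using nz by (simp add: S_def)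
    ultimately have "2 * a + 4 * b + 6 * d = w" "2 * a0 + 4 * b0 + 6 * d0 = w" using S by blast+
    then have "a = a0 \<and> d = d0 \<Longrightarrow> b = b0" by simp
    then show "coeff (coeff (monom (monom (g (a, b, d)) d) a) a0) d0 = (if (a, b, d) = (a0, b0, d0) then g (a, b, d) else 0)"
      by auto
  qed
  also have "\<dots> = g (a0, b0, d0)" using fin nz by (simp add: S_def)
  finally have "g (a0, b0, d0) = 0" using \<open>P = 0\<close> by simp
  then show False using nz by (simp add: g_def monom_const_def)
qed

section \<open>The discriminant 1728 Delta and vanishing orders of modular forms\<close>

definition disc :: "complex fps" where "disc = E4 ^ 3 - E6 ^ 2"

text \<open>The monomial E4^b E6^d of weight w with d = 0 or 1 (meaningful for even w other than 2).\<close>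
definition canonical_form :: "nat \<Rightarrow> complex fps" where
  "canonical_form w = E4 ^ ((w - 6 * (w div 2 mod 2)) div 4) * E6 ^ (w div 2 mod 2)"

text \<open>Below weight 12 the truncated w - 12 would be 0 and let constants through, hence the
  explicit g = 0.\<close>

definition disc_cofactor :: "nat \<Rightarrow> complex fps \<Rightarrow> bool" where
  "disc_cofactor w g \<longleftrightarrow> (if w < 12 then g = 0 else modular_form (w - 12) g)"

lemma disc_cofactor_zero: "disc_cofactor w 0" by (simp add: disc_cofactor_def modular_form.zero)

lemma modular_form_E_mono: "w = 4 * b + 6 * d \<Longrightarrow> modular_form w (E4 ^ b * E6 ^ d)"
proof -
  assume "w = 4 * b + 6 * d"
  then have "modular_form w (fps_const (240 ^ b * (-504) ^ d) * G 4 ^ b * G 6 ^ d)" by (rule modular_form.mono)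
  then show ?thesis unfolding E4_def E6_def power_mult_distrib fps_const_power
    by (simp only: fps_const_mult[symmetric] mult_ac)
qed

text \<open>Repeatedly replacing E6^2 by E4^3 - \<open>disc\<close> lowers the exponent of E6 by 2
  until it is 0 or 1.\<close>

lemma monomial_canonical:
  "w = 4 * b + 6 * d \<Longrightarrow> \<exists>g. disc_cofactor w g \<and> E4 ^ b * E6 ^ d = canonical_form w + disc * g"
proof (induction d arbitrary: b rule: less_induct)
  case (less d)
  show ?case
  proof (cases "d < 2")
    case True
    have w: "w = 2 * (2 * b + 3 * d)" using less.prems by simp
    have "w div 2 = 2 * (b + d) + d" by (subst w) simp
    moreover have "(2 * (b + d) + d) mod 2 = d" using less_2_cases[OF True] by auto
    ultimately have "w div 2 mod 2 = d" by simp
    moreover have "(w - 6 * d) div 4 = b" using less.prems by simp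
    ultimately have "E4 ^ b * E6 ^ d = canonical_form w" by (simp add: canonical_form_def)
    then show ?thesis using disc_cofactor_zero by (intro exI[of _ 0]) auto
  next
    case False
    then obtain e where e: "d = e + 2" by (metis add.commute le_Suc_ex not_less)
    then obtain g where g: "disc_cofactor w g" "E4 ^ (b + 3) * E6 ^ e = canonical_form w + disc * g"
      using less.IH[of e "b + 3"] less.prems by auto
    have "modular_form (w - 12) (E4 ^ b * E6 ^ e)" "\<not> w < 12"
      using e less.prems by (auto intro: modular_form_E_mono)
    then have "disc_cofactor w (g - E4 ^ b * E6 ^ e)"
      using g by (simp add: disc_cofactor_def modular_form_diff)
    moreover have "E4 ^ b * E6 ^ d = E4 ^ (b + 3) * E6 ^ e - disc * (E4 ^ b * E6 ^ e)"
      by (simp add: e disc_def power_add power2_eq_square algebra_simps)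
    ultimately show ?thesis unfolding g by (intro exI[of _ "g - E4 ^ b * E6 ^ e"]) (simp add: algebra_simps)
  qed
qed

lemma modular_form_canonical:
  "modular_form w f \<Longrightarrow> \<exists>c g. disc_cofactor w g \<and> f = fps_const c * canonical_form w + disc * g"
proof (induction rule: modular_form.induct)
  case (zero w)
  then show ?case using disc_cofactor_zero by (intro exI[of _ 0]) auto
next
  case (mono w b d c)
  obtain g where g: "disc_cofactor w g" "E4 ^ b * E6 ^ d = canonical_form w + disc * g"
    using monomial_canonical[OF mono] by blast
  define k where "k = c * (1/240) ^ b * (-1/504) ^ d"
  have "fps_const c * G 4 ^ b * G 6 ^ d = fps_const k * (E4 ^ b * E6 ^ d)"
    unfolding G_E k_def power_mult_distrib fps_const_power fps_const_mult[symmetric] by (simp only: mult_ac)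
  also have "\<dots> = fps_const k * canonical_form w + disc * (fps_const k * g)"
    unfolding g by (simp add: algebra_simps)
  finally show ?case using g
    by (intro exI[of _ k] exI[of _ "fps_const k * g"]) (auto simp: disc_cofactor_def modular_form_scale)
next
  case (add w f f')
  then obtain c g c' g' where "disc_cofactor w g" "f = fps_const c * canonical_form w + disc * g"
    "disc_cofactor w g'" "f' = fps_const c' * canonical_form w + disc * g'" by blast
  then show ?case
    by (intro exI[of _ "c + c'"] exI[of _ "g + g'"])
       (auto simp: disc_cofactor_def modular_form.add algebra_simps simp flip: fps_const_add split: if_splits)
qed

lemma disc_nth: "fps_nth disc 0 = 0" "fps_nth disc 1 = 1728"
proof -
  have n: "fps_nth E4 (Suc 0) = 240" "fps_nth E6 (Suc 0) = -504" using E_nth by simp_all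
  show "fps_nth disc 0 = 0" "fps_nth disc 1 = 1728"
    by (simp_all add: disc_def power2_eq_square power3_eq_cube fps_mult_nth E_nth n)
qed

text \<open>Takes the place of the valence formula. The canonical form has constant term 1, so a
  vanishing constant term leaves f = \<open>disc\<close> * g; \<open>disc\<close> is q times a unit,
  so g has weight w - 12 and vanishes to one order less.\<close>

lemma modular_form_eq_0:
  assumes "modular_form w f" "\<And>i. 12 * i \<le> w \<Longrightarrow> fps_nth f i = 0"
  shows "f = 0"
  using assms
proof (induction w arbitrary: f rule: less_induct)
  case (less w)
  obtain c g where g: "disc_cofactor w g" "f = fps_const c * canonical_form w + disc * g"
    using modular_form_canonical[OF less.prems(1)] by blast
  have "fps_nth f 0 = c"
    unfolding g by (simp add: canonical_form_def disc_nth fps_power_zeroth E_nth)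
  then have f: "f = disc * g" using less.prems(2)[of 0] g by simp
  show ?case
  proof (cases "w < 12")
    case True
    then show ?thesis using f g by (simp add: disc_cofactor_def)
  next
    case False
    define u where "u = fps_shift 1 disc"
    have u: "disc = fps_X * u"
      by (rule fps_ext) (auto simp: u_def disc_nth fps_X_mult_nth)
    have "inverse u * u = 1" by (rule inverse_mult_eq_1) (simp add: u_def disc_nth[unfolded One_nat_def])
    then have g': "g = inverse u * (u * g)" by (simp flip: mult.assoc)
    have ug: "fps_nth (u * g) i = 0" if "12 * i \<le> w - 12" for i
    proof -
      have "fps_nth (u * g) i = fps_nth f (Suc i)" by (simp add: f u mult.assoc)
      then show ?thesis using less.prems(2)[of "Suc i"] that False by simp
    qed
    have "g = 0"
    proof (rule less.IH[of "w - 12"])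
      show "modular_form (w - 12) g" using g False by (simp add: disc_cofactor_def)
      fix i assume i: "12 * i \<le> w - 12"
      have "fps_nth (inverse u * (u * g)) i = 0"
        unfolding fps_mult_nth[of "inverse u"] using i by (intro sum.neutral) (auto simp: ug)
      then show "fps_nth g i = 0" using g' by simp
    qed (use False in simp)
    then show ?thesis using f by simp
  qed
qed

text \<open>Algebraic independence turns the vanishing of the G2-derivative as a q-series into that
  of its coefficients, so no monomial of the difference contains G2.\<close>

lemma prop_a_diff_modular:
  assumes "prop_a F" "prop_a F'" "k = 0 \<or> F (k - 1) = F' (k - 1)"
  shows "modular_form (2 * k) (F k - F' k)"
proof -
  obtain c where c: "qm_homog (2 * k) c" "F k = qm_eval c" "qm_eval (qm_dG2 c) = 2 * (if k = 0 then 0 else F (k - 1))"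
    using assms(1) unfolding prop_a_def by blast
  obtain c' where c': "qm_homog (2 * k) c'" "F' k = qm_eval c'" "qm_eval (qm_dG2 c') = 2 * (if k = 0 then 0 else F' (k - 1))"
    using assms(2) unfolding prop_a_def by blast
  define e where "e = (\<lambda>x. c x + (-1) * c' x)"
  have e: "qm_homog (2 * k) e" unfolding e_def by (rule qm_homog_lincomb[OF c(1) c'(1)])
  have "qm_eval (qm_dG2 e) = qm_eval (qm_dG2 c) + fps_const (-1) * qm_eval (qm_dG2 c')"
    unfolding e_def qm_dG2_lincomb by (rule qm_eval_lincomb[OF qm_homog_dG2'[OF c(1)] qm_homog_dG2'[OF c'(1)]])
  also have "\<dots> = 0" using c c' assms(3) by (auto simp flip: fps_const_neg)
  finally have "qm_dG2 e = (\<lambda>_. 0)" using qm_eval_eq_0[OF qm_homog_dG2'[OF e]] by simp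
  then have dz: "of_nat (a + 1) * e (a + 1, b, d) = 0" for a b d
    unfolding qm_dG2_def by (metis (mono_tags, lifting) case_prod_conv)
  have az: "e (a, b, d) \<noteq> 0 \<Longrightarrow> a = 0" for a b d
    using dz[of "a - 1" b d] by (cases a) (auto simp del: of_nat_Suc)
  have "F k - F' k = qm_eval e"
    using qm_eval_lincomb[OF c(1) c'(1), of "-1"] c c' by (simp add: e_def flip: fps_const_neg)
  also have "\<dots> = (\<Sum>x | e x \<noteq> 0. fps_const (e x) * monom_val x)"
    by (rule qm_eval_eq[OF qm_homog_finite[OF e]]) simp
  also have "modular_form (2 * k) \<dots>"
  proof (rule modular_form_sum, clarify)
    fix a b d assume nz: "e (a, b, d) \<noteq> 0"
    then have "a = 0" by (rule az)
    moreover have "2 * a + 4 * b + 6 * d = 2 * k" using e nz by (auto simp: qm_homog_def)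
    ultimately show "modular_form (2 * k) (fps_const (e (a, b, d)) * monom_val (a, b, d))"
      using modular_form.mono[of "2 * k" b d "e (a, b, d)"] by (simp add: monom_val_def mult.assoc)
  qed
  finally show ?thesis .
qed

text \<open>The difference of the two polynomials has degree at most 2 m but more than 2 m
  roots.\<close>

lemma prop_b_coeff_unique:
  assumes "prop_b F" "prop_b F'" "finite K" "card K > 2 * m" "K \<subseteq> {m..}"
    and "\<And>k. k \<in> K \<Longrightarrow> fps_nth (F k) m = fps_nth (F' k) m" and "k \<ge> m"
  shows "fps_nth (F k) m = fps_nth (F' k) m"
proof -
  obtain p where p: "degree p = 2 * m"
    "\<And>k. k \<ge> m \<Longrightarrow> fps_nth (F k) m = poly p (of_nat k) / ((-4) ^ k * of_nat (odd_dfact k))"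
    using assms(1) unfolding prop_b_def by blast
  obtain p' where p': "degree p' = 2 * m"
    "\<And>k. k \<ge> m \<Longrightarrow> fps_nth (F' k) m = poly p' (of_nat k) / ((-4) ^ k * of_nat (odd_dfact k))"
    using assms(2) unfolding prop_b_def by blast
  have "p - p' = 0"
  proof (rule ccontr)
    assume nz: "p - p' \<noteq> 0"
    have "of_nat ` K \<subseteq> {x. poly (p - p') x = 0}"
    proof clarify
      fix k assume "k \<in> K"
      then have "poly p (of_nat k) / ((-4) ^ k * of_nat (odd_dfact k)) = poly p' (of_nat k) / ((-4) ^ k * of_nat (odd_dfact k))"
        using assms(5,6) p(2)[of k] p'(2)[of k] by auto
      then show "poly (p - p') (of_nat k) = 0" using odd_dfact_pos[of k] by simp
    qed
    then have "card (of_nat ` K :: complex set) \<le> card {x. poly (p - p') x = 0}"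
      by (rule card_mono[OF poly_roots_finite[OF nz]])
    also have "\<dots> \<le> degree (p - p')" by (rule card_poly_roots_bound[OF nz])
    also have "\<dots> \<le> 2 * m" using p p' by (intro degree_diff_le) auto
    finally show False using assms(4) by (simp add: card_image)
  qed
  then show ?thesis using p(2)[OF assms(7)] p'(2)[OF assms(7)] by simp
qed

text \<open>The two conditions bootstrap each other: equality for k < 6 n determines p_0, ..., p_n,
  since p_m is known at the 5 m > 2 m points m \<le> k < 6 m (and p_0 at k = 0, by (c)); then for k < 6 n + 6 the difference is
  a modular form of weight 2 k < 12 (n + 1) vanishing to order greater than n.\<close>
lemma uniqueness:
  assumes F: "prop_a F" "prop_b F" "prop_c F" and F': "prop_a F'" "prop_b F'" "prop_c F'"
  shows "F = F'"
proof -
  have "\<forall>k < 6 * n. F k = F' k" for n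
  proof (induction n)
    case (Suc n)
    have coeff: "fps_nth (F k) m = fps_nth (F' k) m" if "m \<le> n" "m \<le> k" for m k
    proof (rule prop_b_coeff_unique[OF F(2) F'(2), where K = "if m = 0 then {0} else {m..<6 * m}"])
      fix j assume "j \<in> (if m = 0 then {0} else {m..<6 * m})"
      then show "fps_nth (F j) m = fps_nth (F' j) m"
        using Suc.IH F(3) F'(3) that by (auto simp: prop_c_def split: if_splits)
    qed (use that in \<open>auto split: if_splits\<close>)
    show ?case
    proof (intro allI impI)
      fix k assume "k < 6 * Suc n"
      then show "F k = F' k"
      proof (induction k rule: less_induct)
        case (less k)
        have "k = 0 \<or> F (k - 1) = F' (k - 1)" using less.IH[of "k - 1"] less.prems by (cases k) auto
        then have "modular_form (2 * k) (F k - F' k)" by (rule prop_a_diff_modular[OF F(1) F'(1)])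
        \<comment> \<open>From 12 i <= 2 k < 12 (n + 1) follows i <= n, the range in which the
          polynomials are already determined.\<close>
        moreover have "fps_nth (F k - F' k) i = 0" if "12 * i \<le> 2 * k" for i
          using coeff[of i k] that less.prems by simp
        ultimately have "F k - F' k = 0" by (rule modular_form_eq_0)
        then show ?case by simp
      qed
    qed
  qed simp
  moreover have "k < 6 * Suc k" for k :: nat by simp
  ultimately have "F k = F' k" for k by blast
  then show ?thesis by auto
qed

theorem theorem3p1:
  shows "prop_a A \<and> prop_b A \<and> prop_c A \<and>
         (\<forall>F. prop_a F \<and> prop_b F \<and> prop_c F \<longrightarrow> F = A)"
  using prop_a_A prop_b_A prop_c_A uniqueness by blast

end
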